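(* The sample complexity of learning discrete distributions over a known domain of size $k$ in Kullback--Leibler divergence, to accuracy $\varepsilon$ and with error probability $\delta$, satisfies $$\Phi(\mathrm{KL},k,\varepsilon,\delta) = \Theta\left(\frac{k+\log(1/\delta)}{\varepsilon}\right),$$ where by $\mathrm{KL}$ we refer to minimizing $\mathrm{KL}(\hat p\,\|\,p)$, with $p$ the unknown distribution and $\hat p$ the learned one (in that order of arguments).
   Context: Let $[k]=\{1,\dots,k\}$ and let $\Delta([k])$ be the set of probability distributions on $[k]$. For $p,q\in\Delta([k])$, the Kullback--Leibler divergence is $\mathrm{KL}(p\,\|\,q)=\sum_{i=1}^k p(i)\ln\frac{p(i)}{q(i)}\in[0,\infty]$, with the usual conventions that terms with $p(i)=0$ contribute $0$ and terms with $p(i)>0=q(i)$ contribute $+\infty$. For an accuracy $\varepsilon>0$ and an error probability $\delta\in(0,1]$, $\Phi(\mathrm{KL},k,\varepsilon,\delta)$ denotes the sample complexity of learning discrete distributions over the known domain $[k]$. That is, it is the smallest integer $n$ for which there is a (possibly randomized) estimator which, given $n$ i.i.d. samples from an unknown $p\in\Delta([k])$, outputs $\hat p\in\Delta([k])$ such that, for every $p\in\Delta([k])$, $\Pr[\mathrm{KL}(\hat p\,\|\,p)\le\varepsilon]\ge 1-\delta$. Asymptotics are taken with regard to $k$ going to infinity, $\varepsilon$ going to $0$, and $\delta$ going to $0$ (in that order). Thus $\Phi=\Theta(g)$ means that there are absolute constants $0<c\le C$, $k_0$, $\varepsilon_0>0$, $\delta_0>0$ such that $c\,g\le\Phi\le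 C\,g$ for all $k\ge k_0$, $0<\varepsilon\le\varepsilon_0$, $0<\delta\le\delta_0$. *)

theory Defs
  imports "HOL-Probability.Probability"
begin

definition prob_simplex :: "nat \<Rightarrow> nat pmf set" where
  "prob_simplex k = {p. set_pmf p \<subseteq> {1..k}}"

text \<open>The Borel \<open>\<sigma>\<close>-algebra of the simplex, generated by the coordinate maps
  \<open>p \<mapsto> pmf p i\<close>; the output of a randomized estimator is distributed according to a
  probability measure on this space, not necessarily a discrete one.\<close>

definition simplex_space :: "nat \<Rightarrow> nat pmf measure" where
  "simplex_space k = vimage_algebra (prob_simplex k) pmf (\<Pi>\<^sub>M i\<in>UNIV. borel)"

text \<open>The library's \<open>KL_divergence\<close> is real-valued and does not yield \<open>\<infinity>\<close> when absolute
  continuity fails, so the sum is written out over the extended reals. No summand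
  is \<open>-\<infinity>\<close>, so a single infinite term makes the sum infinite.\<close>

definition KL :: "nat \<Rightarrow> nat pmf \<Rightarrow> nat pmf \<Rightarrow> ereal" where
  "KL k p q = (\<Sum>i\<in>{1..k}.
     if pmf p i = 0 then 0
     else if pmf q i = 0 then \<infinity>
     else ereal (pmf p i * ln (pmf p i / pmf q i)))"

text \<open>A randomized estimator is a Markov kernel \<open>A\<close> from sample lists to the simplex. Binding
  it to the law of \<open>n\<close> i.i.d. samples gives the law of the learned distribution. The divergence
  \<open>D\<close> takes the learned distribution first and the unknown one second.\<close>

definition learnable ::
  "(nat pmf \<Rightarrow> nat pmf \<Rightarrow> ereal) \<Rightarrow> nat \<Rightarrow> real \<Rightarrow> real \<Rightarrow> nat \<Rightarrow> bool" where
  "learnable D k \<epsilon> \<delta> n \<longleftrightarrow>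
     (\<exists>A \<in> count_space UNIV \<rightarrow>\<^sub>M prob_algebra (simplex_space k).
        \<forall>p \<in> prob_simplex k.
          measure (measure_pmf (replicate_pmf n p) \<bind> A)
            {q \<in> prob_simplex k. D q p \<le> ereal \<epsilon>} \<ge> 1 - \<delta>)"

text \<open>The infimum of the empty set is \<open>\<infinity>\<close>, so finiteness of the sample complexity includes the
  existence of a suitable estimator.\<close>

definition sample_complexity ::
  "(nat pmf \<Rightarrow> nat pmf \<Rightarrow> ereal) \<Rightarrow> nat \<Rightarrow> real \<Rightarrow> real \<Rightarrow> enat" where
  "sample_complexity D k \<epsilon> \<delta> = Inf {enat n | n. learnable D k \<epsilon> \<delta> n}"

lemma space_simplex_space [simp]: "space (simplex_space k) = prob_simplex k"
  by (simp add: simplex_space_def)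

lemma measurable_pmf_simplex_space [measurable]:
  "(\<lambda>q. pmf q i) \<in> borel_measurable (simplex_space k)"
proof -
  have "pmf \<in> simplex_space k \<rightarrow>\<^sub>M (\<Pi>\<^sub>M i\<in>UNIV. borel)"
    unfolding simplex_space_def
    by (rule measurable_vimage_algebra1) (auto simp: space_PiM)
  then show ?thesis
    by (rule measurable_compose) (rule measurable_component_singleton, simp)
qed

lemma KL_ball_in_sets: "{q \<in> prob_simplex k. KL k q p \<le> ereal \<epsilon>} \<in> sets (simplex_space k)"
proof -
  have "(\<lambda>q. KL k q p) \<in> borel_measurable (simplex_space k)"
    unfolding KL_def by measurable
  then have "{q \<in> space (simplex_space k). KL k q p \<le> ereal \<epsilon>} \<in> sets (simplex_space k)"
    by measurable
  then show ?thesis by simp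
qed

end

theory Submission imports Defs begin

text \<open>The empirical distribution attains the upper bound. The product of the likelihood of a sample and
  \<open>exp (n * KL / 2)\<close> is a product of functions of the counts, so its sum over all samples is bounded
  by splitting off one letter at a time. Each step costs the factor 9, because for a binomial count
  \<open>exp (n * KL / 2)\<close> has bounded mean by the Chernoff tail bounds. Hence
  \<open>P (KL > \<epsilon>) \<le> 9 ^ k * exp (- n * \<epsilon> / 2)\<close>.

  Both lower bounds exploit that \<open>KL q p\<close> is infinite as soon as \<open>q\<close> charges a point outside the
  support of \<open>p\<close>. Spread mass of order \<open>\<epsilon>\<close> uniformly over an unknown \<open>S \<subseteq> {2..k}\<close> and put the rest on 1.
  With few samples most of \<open>S\<close> is unseen, yet an accurate output must charge some unseen point, and it
  cannot tell whether that point belongs to \<open>S\<close>.\<close>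

section \<open>The empirical distribution\<close>

text \<open>A layer-cake bound that turns tail estimates at the levels \<open>4 ^ j\<close> into a
  bound on the mean of \<open>sqrt r\<close>. If \<open>j\<close> is the last level below
  \<open>r\<close>, the single summand \<open>2 ^ Suc j\<close> already dominates
  \<open>sqrt r\<close>; for \<open>r < 1\<close> the constant 1 does.\<close>

lemma sqrt_le_dyadic_sum:
  fixes r :: real
  assumes "0 \<le> r" "r < 4 ^ J"
  shows "sqrt r \<le> 1 + (\<Sum>j<J. if 4 ^ j \<le> r then 2 ^ Suc j else 0)"
  using assms
proof (induction J)
  case 0
  then show ?case by simp
next
  case (Suc J)
  show ?case
  proof (cases "r < 4 ^ J")
    case True
    then show ?thesis using Suc by simp
  next
    case False
    have "(4::real) ^ Suc J = (2 ^ Suc J)\<^sup>2"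
      by (simp only: power2_eq_square flip: power_mult_distrib) simp
    then have "sqrt r \<le> 2 ^ Suc J"
      using Suc.prems by (intro real_le_lsqrt) auto
    moreover have "0 \<le> (\<Sum>j<J. if 4 ^ j \<le> r then 2 ^ Suc j else (0::real))"
      by (intro sum_nonneg) auto
    ultimately show ?thesis using False by simp
  qed
qed

text \<open>Chernoff's bound by change of measure. \<open>L m\<close> is the likelihood of
  \<open>m\<close> successes under their own frequency \<open>m / n\<close>, so the sum runs over
  counts at or above the mean whose likelihood ratio against \<open>q\<close> is at least
  \<open>s\<close>. Let \<open>b\<close> be the least such count and
  \<open>\<alpha> = b / n\<close>. From \<open>b\<close> on, the \<open>q\<close>-likelihood is at
  most \<open>1 / s\<close> times the \<open>\<alpha>\<close>-likelihood, and the binomial weights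
  for \<open>\<alpha>\<close> sum to 1.\<close>

lemma binomial_likelihood_tail:
  fixes q s :: real
  assumes q: "0 < q" "q < 1" and s: "0 < s" and n: "0 < n"
  defines "L \<equiv> (\<lambda>m. (real m / n) ^ m * (real (n - m) / n) ^ (n - m))"
  shows "(\<Sum>m | m \<le> n \<and> n * q \<le> m \<and> s * (q ^ m * (1 - q) ^ (n - m)) \<le> L m.
           (n choose m) * (q ^ m * (1 - q) ^ (n - m))) \<le> 1 / s"
proof -
  define w where "w m = q ^ m * (1 - q) ^ (n - m)" for m
  define U where "U = {m. m \<le> n \<and> n * q \<le> m \<and> s * w m \<le> L m}"
  have finU: "finite U"
    by (simp add: U_def)
  show ?thesis
  proof (cases "U = {}")
    case True
    then show ?thesis using s unfolding U_def w_def by (simp only: sum.empty) simp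
  next
    case False
    define b where "b = Min U"
    have bU: "b \<in> U" and bmin: "m \<in> U \<Longrightarrow> b \<le> m" for m
      using False finU by (auto simp: b_def)
    define \<alpha> where "\<alpha> = real b / n"
    have bn: "b \<le> n" "n * q \<le> b" "s * w b \<le> L b"
      using bU by (auto simp: U_def)
    have "q \<le> \<alpha>" "\<alpha> \<le> 1"
      using bn n by (auto simp: \<alpha>_def field_simps)
    with q have \<alpha>: "q \<le> \<alpha>" "\<alpha> \<le> 1" "0 < \<alpha>"
      by auto
    have Lb: "L b = \<alpha> ^ b * (1 - \<alpha>) ^ (n - b)"
      using n bn by (simp add: L_def \<alpha>_def of_nat_diff diff_divide_distrib)
    have w_pos: "0 < w m" for m
      using q by (simp add: w_def)
    \<comment> \<open>Each further success multiplies the ratio of the \<open>q\<close>-likelihood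
      to the \<open>\<alpha>\<close>-likelihood by a factor at most 1, because
      \<open>q \<le> \<alpha>\<close>; the ratio is therefore largest at
      \<open>m = b\<close>.\<close>
    have ratio: "w m * L b \<le> \<alpha> ^ m * (1 - \<alpha>) ^ (n - m) * w b" if m: "m \<in> U" for m
    proof -
      obtain d where d: "m = b + d"
        using bmin[OF m] le_Suc_ex by blast
      have "m \<le> n"
        using m by (simp add: U_def)
      then have nb: "n - b = (n - m) + d"
        using d by simp
      have "q * (1 - \<alpha>) \<le> \<alpha> * (1 - q)"
        using \<alpha> by (simp add: algebra_simps)
      then have "(q * (1 - \<alpha>)) ^ d \<le> (\<alpha> * (1 - q)) ^ d"
        using q \<alpha> by (intro power_mono) auto
      then have "(q ^ b * (1 - q) ^ (n - m) * \<alpha> ^ b * (1 - \<alpha>) ^ (n - m)) * (q * (1 - \<alpha>)) ^ d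
          \<le> (q ^ b * (1 - q) ^ (n - m) * \<alpha> ^ b * (1 - \<alpha>) ^ (n - m)) * (\<alpha> * (1 - q)) ^ d"
        using q \<alpha> by (intro mult_left_mono) auto
      then show ?thesis
        unfolding Lb w_def nb d by (simp add: power_add power_mult_distrib mult_ac)
    qed
    have "(\<Sum>m\<in>U. (n choose m) * w m) * L b = (\<Sum>m\<in>U. (n choose m) * (w m * L b))"
      unfolding sum_distrib_right by (simp add: mult_ac)
    also have "\<dots> \<le> (\<Sum>m\<in>U. (n choose m) * (\<alpha> ^ m * (1 - \<alpha>) ^ (n - m) * w b))"
      using ratio by (intro sum_mono mult_left_mono) auto
    also have "\<dots> \<le> (\<Sum>m\<le>n. (n choose m) * (\<alpha> ^ m * (1 - \<alpha>) ^ (n - m) * w b))"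
      using w_pos[of b] \<alpha> by (intro sum_mono2) (auto simp: U_def)
    also have "\<dots> = (\<Sum>m\<le>n. (n choose m) * \<alpha> ^ m * (1 - \<alpha>) ^ (n - m)) * w b"
      unfolding sum_distrib_right by (simp add: mult_ac)
    also have "\<dots> = w b"
      by (simp flip: binomial_ring)
    finally have *: "(\<Sum>m\<in>U. (n choose m) * w m) * L b \<le> w b" .
    have "(\<Sum>m\<in>U. (n choose m) * w m) * (s * w b) \<le> (\<Sum>m\<in>U. (n choose m) * w m) * L b"
      using bn by (intro mult_left_mono sum_nonneg mult_nonneg_nonneg less_imp_le[OF w_pos]) auto
    with * have "(\<Sum>m\<in>U. (n choose m) * w m) * s * w b \<le> 1 * w b"
      by (simp add: mult_ac)
    then have "(\<Sum>m\<in>U. (n choose m) * w m) * s \<le> 1"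
      using w_pos[of b] by (subst (asm) mult_le_cancel_right) auto
    then show ?thesis
      using s by (simp add: U_def w_def field_simps)
  qed
qed

text \<open>Counting failures instead of successes, \<open>m \<mapsto> n - m\<close>, turns the
  lower tail for \<open>q\<close> into the upper tail for \<open>1 - q\<close>.\<close>

lemma binomial_likelihood_tail_lower:
  fixes q s :: real
  assumes q: "0 < q" "q < 1" and s: "0 < s" and n: "0 < n"
  defines "L \<equiv> (\<lambda>m. (real m / n) ^ m * (real (n - m) / n) ^ (n - m))"
  shows "(\<Sum>m | m \<le> n \<and> m \<le> n * q \<and> s * (q ^ m * (1 - q) ^ (n - m)) \<le> L m.
           (n choose m) * (q ^ m * (1 - q) ^ (n - m))) \<le> 1 / s" (is "sum ?f ?A \<le> _")
proof -
  let ?q = "1 - q"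
  let ?B = "{m. m \<le> n \<and> n * ?q \<le> m \<and> s * (?q ^ m * (1 - ?q) ^ (n - m)) \<le> L m}"
  have "sum ?f ?A = (\<Sum>m\<in>?B. (n choose m) * (?q ^ m * (1 - ?q) ^ (n - m)))"
    by (rule sum.reindex_bij_witness[of _ "\<lambda>m. n - m" "\<lambda>m. n - m"])
      (auto simp: L_def of_nat_diff algebra_simps simp flip: binomial_symmetric)
  also have "\<dots> \<le> 1 / s"
    unfolding L_def using binomial_likelihood_tail[of ?q s n] q s n by simp
  finally show ?thesis .
qed

text \<open>Up to the factor \<open>sqrt (n ^ n)\<close>, the sum is the mean of
  \<open>sqrt (L / w) = exp (n * KL / 2)\<close> for a binomial count. The level
  \<open>4 ^ j\<close> is exceeded with probability at most \<open>2 / 4 ^ j\<close>, while the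
  layer has height \<open>2 ^ Suc j\<close>; the geometric series gives
  \<open>1 + 8\<close>.\<close>

lemma sum_binomial_sqrt_likelihood:
  fixes q :: real
  assumes q: "0 < q" "q < 1" and n: "0 < n"
  shows "(\<Sum>m\<le>n. (n choose m) * sqrt ((m * q) ^ m * (real (n - m) * (1 - q)) ^ (n - m)))
    \<le> 9 * sqrt (real n ^ n)"
proof -
  define w where "w m = q ^ m * (1 - q) ^ (n - m)" for m
  define L where "L m = (real m / n) ^ m * (real (n - m) / n) ^ (n - m)" for m
  define r where "r m = L m / w m" for m
  have w_pos: "0 < w m" for m
    using q by (simp add: w_def)
  have L_nn: "0 \<le> L m" for m
    by (simp add: L_def)
  have r_nn: "0 \<le> r m" for m
    using w_pos[of m] L_nn[of m] by (simp add: r_def)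
  obtain J where J: "\<And>m. m \<le> n \<Longrightarrow> r m < 4 ^ J"
  proof -
    obtain J where "Max (r ` {..n}) < 4 ^ J"
      using real_arch_pow[of 4 "Max (r ` {..n})"] by auto
    then show thesis
      by (intro that[of J]) (auto simp: Max_less_iff[of "r ` {..n}"])
  qed
  \<comment> \<open>The two one-sided tails cover the event, hence the factor 2.\<close>
  have tail: "(\<Sum>m\<le>n. if 4 ^ j \<le> r m then (n choose m) * w m else 0) \<le> 2 / 4 ^ j" for j
  proof -
    define A where "A = {m. m \<le> n \<and> n * q \<le> m \<and> 4 ^ j * w m \<le> L m}"
    define B where "B = {m. m \<le> n \<and> m \<le> n * q \<and> 4 ^ j * w m \<le> L m}"
    have fin: "finite A" "finite B"
      by (auto simp: A_def B_def)
    have "(\<Sum>m\<le>n. if 4 ^ j \<le> r m then (n choose m) * w m else 0)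
        = (\<Sum>m\<in>{m\<in>{..n}. 4 ^ j \<le> r m}. (n choose m) * w m)"
      by (simp only: sum.inter_filter[OF finite_atMost])
    also have "{m\<in>{..n}. 4 ^ j \<le> r m} = A \<union> B"
      using w_pos by (auto simp: A_def B_def r_def pos_le_divide_eq)
    also have "(\<Sum>m\<in>A \<union> B. (n choose m) * w m)
        \<le> (\<Sum>m\<in>A. (n choose m) * w m) + (\<Sum>m\<in>B. (n choose m) * w m)"
      using fin w_pos sum_nonneg[of "A \<inter> B" "\<lambda>m. (n choose m) * w m"]
      by (simp add: sum_Un less_imp_le)
    also have "\<dots> \<le> 1 / 4 ^ j + 1 / 4 ^ j"
      using binomial_likelihood_tail[OF q _ n, of "4 ^ j"]
        binomial_likelihood_tail_lower[OF q _ n, of "4 ^ j"]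
      unfolding A_def B_def L_def w_def by (intro add_mono) simp_all
    finally show ?thesis by simp
  qed
  have "(\<Sum>m\<le>n. (n choose m) * w m * sqrt (r m))
      \<le> (\<Sum>m\<le>n. (n choose m) * w m * (1 + (\<Sum>j<J. if 4 ^ j \<le> r m then 2 ^ Suc j else 0)))"
    using sqrt_le_dyadic_sum[OF r_nn J] w_pos by (intro sum_mono mult_left_mono) (auto intro: less_imp_le)
  also have "\<dots> = (\<Sum>m\<le>n. (n choose m) * w m)
      + (\<Sum>m\<le>n. \<Sum>j<J. 2 ^ Suc j * (if 4 ^ j \<le> r m then (n choose m) * w m else 0))"
    by (simp only: distrib_left sum.distrib sum_distrib_left mult_1_right)
      (intro arg_cong2[of _ _ _ _ "(+)"] refl sum.cong, auto)
  also have "(\<Sum>m\<le>n. (n choose m) * w m) = 1"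
    using binomial_ring[of q "1 - q" n] by (simp add: w_def mult_ac)
  also have "(\<Sum>m\<le>n. \<Sum>j<J. 2 ^ Suc j * (if 4 ^ j \<le> r m then (n choose m) * w m else 0))
      = (\<Sum>j<J. 2 ^ Suc j * (\<Sum>m\<le>n. if 4 ^ j \<le> r m then (n choose m) * w m else 0))"
    by (subst sum.swap) (simp only: sum_distrib_left)
  also have "\<dots> \<le> (\<Sum>j<J. 2 ^ Suc j * (2 / 4 ^ j))"
    using tail by (intro sum_mono mult_left_mono) auto
  also have "\<dots> = 4 * (\<Sum>j<J. (1 / 2) ^ j)"
  proof -
    have "(2::real) ^ Suc j * (2 / 4 ^ j) = 4 * (1 / 2) ^ j" for j
    proof -
      have "(4::real) ^ j = 2 ^ j * 2 ^ j"
        by (simp flip: power_mult_distrib)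
      then show ?thesis
        by (simp add: power_one_over)
    qed
    then show ?thesis
      by (simp only: sum_distrib_left)
  qed
  also have "\<dots> \<le> 8"
    by (simp add: sum_gp_strict)
  finally have main: "(\<Sum>m\<le>n. (n choose m) * w m * sqrt (r m)) \<le> 9" by simp
  \<comment> \<open>Here \<open>w m * sqrt (r m) = sqrt (w m * L m)\<close>, and
    \<open>n ^ n\<close> comes from clearing the denominators of \<open>L m\<close>.\<close>
  have "sqrt ((m * q) ^ m * (real (n - m) * (1 - q)) ^ (n - m)) = w m * sqrt (r m) * sqrt (real n ^ n)"
    if "m \<le> n" for m
  proof -
    have "real n ^ m * real n ^ (n - m) = real n ^ n"
      using that by (simp flip: power_add)
    then have "(m * q) ^ m * (real (n - m) * (1 - q)) ^ (n - m) = w m ^ 2 * r m * real n ^ n"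
      using n w_pos[of m] that
      by (simp add: r_def L_def power2_eq_square power_divide power_mult_distrib of_nat_diff)
        (simp add: w_def mult_ac)
    then show ?thesis
      using w_pos[of m] by (simp add: real_sqrt_mult less_imp_le)
  qed
  then have "(\<Sum>m\<le>n. (n choose m) * sqrt ((m * q) ^ m * (real (n - m) * (1 - q)) ^ (n - m)))
      = (\<Sum>m\<le>n. (n choose m) * w m * sqrt (r m)) * sqrt (real n ^ n)"
    by (simp add: sum_distrib_right mult.assoc)
  also have "\<dots> \<le> 9 * sqrt (real n ^ n)"
    using main by (intro mult_right_mono) auto
  finally show ?thesis .
qed

text \<open>The homogeneous form needed to split off a letter of weight \<open>a\<close> from others
  of total weight \<open>b\<close>. Scaling by \<open>a + b\<close> reduces it to
  \<open>q = a / (a + b)\<close>. When \<open>q\<close> would be 0 or 1, only the count 0 or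
  \<open>n\<close> contributes, by \<open>0 ^ 0 = 1\<close>.\<close>

lemma sum_binomial_sqrt_weights:
  fixes a b :: real
  assumes a: "0 \<le> a" and b: "0 \<le> b"
  shows "(\<Sum>m\<le>n. (n choose m) * (sqrt ((m * a) ^ m) * sqrt ((real (n - m) * b) ^ (n - m))))
    \<le> 9 * sqrt ((n * (a + b)) ^ n)"
proof -
  consider "n = 0" | "0 < n" "a = 0" | "0 < n" "b = 0" | "0 < n" "0 < a" "0 < b"
    using a b by fastforce
  then show ?thesis
  proof cases
    case 1
    then show ?thesis by simp
  next
    case 2
    have "(\<Sum>m\<le>n. (n choose m) * (sqrt ((m * a) ^ m) * sqrt ((real (n - m) * b) ^ (n - m))))
      = (\<Sum>m\<in>{0}. (n choose m) * (sqrt ((m * a) ^ m) * sqrt ((real (n - m) * b) ^ (n - m))))"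
      using 2 by (intro sum.mono_neutral_right) (auto simp: power_0_left)
    also have "\<dots> = sqrt ((n * (a + b)) ^ n)"
      using 2 by simp
    also have "\<dots> \<le> 9 * \<dots>"
      using a b by simp
    finally show ?thesis .
  next
    case 3
    have "(\<Sum>m\<le>n. (n choose m) * (sqrt ((m * a) ^ m) * sqrt ((real (n - m) * b) ^ (n - m))))
      = (\<Sum>m\<in>{n}. (n choose m) * (sqrt ((m * a) ^ m) * sqrt ((real (n - m) * b) ^ (n - m))))"
      using 3 by (intro sum.mono_neutral_right) (auto simp: power_0_left)
    also have "\<dots> = sqrt ((n * (a + b)) ^ n)"
      using 3 by simp
    also have "\<dots> \<le> 9 * \<dots>"
      using a b by simp
    finally show ?thesis .
  next
    case 4
    define c where "c = a + b"
    define q where "q = a / c"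
    have c: "0 < c"
      using 4 by (simp add: c_def)
    have q: "0 < q" "q < 1"
      using 4 by (auto simp: q_def c_def)
    have ab: "a = q * c" "b = (1 - q) * c"
      using c by (auto simp: q_def c_def field_simps)
    have "sqrt ((m * a) ^ m) * sqrt ((real (n - m) * b) ^ (n - m))
        = sqrt ((m * q) ^ m * (real (n - m) * (1 - q)) ^ (n - m)) * sqrt (c ^ n)" if "m \<le> n" for m
    proof -
      have "c ^ m * c ^ (n - m) = c ^ n"
        using that by (simp flip: power_add)
      then show ?thesis
        unfolding real_sqrt_mult[symmetric] ab power_mult_distrib by (simp add: mult_ac)
    qed
    then have "(\<Sum>m\<le>n. (n choose m) * (sqrt ((m * a) ^ m) * sqrt ((real (n - m) * b) ^ (n - m))))
      = (\<Sum>m\<le>n. (n choose m) * sqrt ((m * q) ^ m * (real (n - m) * (1 - q)) ^ (n - m))) * sqrt (c ^ n)"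
      by (simp add: sum_distrib_right mult.assoc)
    also have "\<dots> \<le> 9 * sqrt (real n ^ n) * sqrt (c ^ n)"
      using c sum_binomial_sqrt_likelihood[OF q 4(1)] by (intro mult_right_mono) auto
    also have "\<dots> = 9 * sqrt ((n * (a + b)) ^ n)"
      by (simp add: c_def power_mult_distrib real_sqrt_mult)
    finally show ?thesis .
  qed
qed

section \<open>Weighted sums over words\<close>

lemma lists_length_0: "{xs. set xs \<subseteq> S \<and> length xs = 0} = {[]}"
  by auto

lemma sum_lists_Suc:
  assumes "finite S"
  shows "(\<Sum>xs | set xs \<subseteq> S \<and> length xs = Suc n. f xs)
    = (\<Sum>x\<in>S. \<Sum>xs | set xs \<subseteq> S \<and> length xs = n. f (x # xs))"
proof -
  have "{xs. set xs \<subseteq> S \<and> length xs = Suc n}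
      = (\<lambda>(x, xs). x # xs) ` (S \<times> {xs. set xs \<subseteq> S \<and> length xs = n})"
    by (auto simp: length_Suc_conv image_iff)
  then show ?thesis
    by (simp add: sum.reindex inj_on_def sum.cartesian_product split_def)
qed

text \<open>Exponential generating functions multiply: a word over \<open>insert a S\<close> is a set of positions for
  \<open>a\<close> together with a word over \<open>S\<close>. In the induction on \<open>n\<close>, removing the first letter
  \<open>x\<close> shifts the weight function \<open>f x\<close>.\<close>

lemma sum_lists_prod_count_insert:
  fixes f :: "'a \<Rightarrow> nat \<Rightarrow> real"
  assumes "finite S" "a \<notin> S"
  shows "(\<Sum>xs | set xs \<subseteq> insert a S \<and> length xs = n. \<Prod>i\<in>insert a S. f i (count_list xs i))
    = (\<Sum>m\<le>n. (n choose m) * (f a m *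
        (\<Sum>xs | set xs \<subseteq> S \<and> length xs = n - m. \<Prod>i\<in>S. f i (count_list xs i))))"
proof -
  define T where "T f S n = (\<Sum>xs | set xs \<subseteq> S \<and> length xs = n. \<Prod>i\<in>S. f i (count_list xs i))"
    for f :: "'a \<Rightarrow> nat \<Rightarrow> real" and S n
  define sh where "sh f x = f(x := (\<lambda>m. f x (Suc m)))" for f :: "'a \<Rightarrow> nat \<Rightarrow> real" and x
  have T_Suc: "T f S (Suc n) = (\<Sum>x\<in>S. T (sh f x) S n)" if "finite S" for f S n
    unfolding T_def sum_lists_Suc[OF that]
    by (intro sum.cong prod.cong refl) (auto simp: sh_def)
  have T_cong: "T f S n = T g S n" if "\<And>i. i \<in> S \<Longrightarrow> f i = g i" for f g S n
    unfolding T_def using that by (intro sum.cong prod.cong) auto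
  have "T f (insert a S) n = (\<Sum>m\<le>n. (n choose m) * (f a m * T f S (n - m)))"
  proof (induction n arbitrary: f)
    case 0
    then show ?case
      using assms unfolding T_def diff_0_eq_0 lists_length_0 by (simp add: lists_length_0)
  next
    case (Suc n)
    have "T f (insert a S) (Suc n)
        = T (sh f a) (insert a S) n + (\<Sum>x\<in>S. T (sh f x) (insert a S) n)"
      using assms by (simp add: T_Suc)
    also have "T (sh f a) (insert a S) n = (\<Sum>m\<le>n. (n choose m) * (f a (Suc m) * T f S (n - m)))"
    proof -
      have "T (sh f a) S j = T f S j" for j
        using assms by (intro T_cong) (auto simp: sh_def)
      then show ?thesis
        unfolding Suc.IH by (simp add: sh_def)
    qed
    also have "(\<Sum>x\<in>S. T (sh f x) (insert a S) n)
        = (\<Sum>x\<in>S. \<Sum>m\<le>n. (n choose m) * (f a m * T (sh f x) S (n - m)))"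
      using assms unfolding Suc.IH by (intro sum.cong refl) (auto simp: sh_def)
    also have "\<dots> = (\<Sum>m\<le>n. (n choose m) * (f a m * T f S (Suc n - m)))"
      using assms by (subst sum.swap) (simp add: T_Suc Suc_diff_le sum_distrib_left)
    \<comment> \<open>The added term \<open>m = Suc n\<close> vanishes since
      \<open>n choose Suc n = 0\<close>. Splitting off \<open>m = 0\<close> then prepares Pascal's
      rule.\<close>
    also have "\<dots> = (\<Sum>m\<le>Suc n. (n choose m) * (f a m * T f S (Suc n - m)))"
      by simp
    also have "\<dots> = f a 0 * T f S (Suc n) + (\<Sum>m\<le>n. (n choose Suc m) * (f a (Suc m) * T f S (n - m)))"
      by (subst sum.atMost_Suc_shift) simp
    also have "(\<Sum>m\<le>n. (n choose m) * (f a (Suc m) * T f S (n - m))) + \<dots>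
        = (\<Sum>m\<le>Suc n. (Suc n choose m) * (f a m * T f S (Suc n - m)))"
      by (simp only: sum.atMost_Suc_shift[of "\<lambda>m. (Suc n choose m) * (f a m * T f S (Suc n - m))"])
        (simp add: sum.distrib algebra_simps)
    finally show ?case .
  qed
  then show ?thesis
    by (simp add: T_def)
qed

text \<open>After a letter \<open>a\<close> is split off, the induction hypothesis lets the
  remaining letters act as one letter of weight \<open>sum p S\<close>. What is left is a binomial
  sum over the count of \<open>a\<close>, so each letter costs one factor 9.\<close>

lemma sum_lists_sqrt_weights:
  fixes p :: "'a \<Rightarrow> real"
  assumes "finite S" "\<And>i. i \<in> S \<Longrightarrow> 0 \<le> p i"
  shows "(\<Sum>xs | set xs \<subseteq> S \<and> length xs = n. \<Prod>i\<in>S. sqrt ((count_list xs i * p i) ^ count_list xs i))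
    \<le> 9 ^ card S * sqrt ((n * sum p S) ^ n)"
  using assms
proof (induction S arbitrary: n rule: finite_induct)
  case empty
  show ?case
  proof (cases n)
    case 0
    then show ?thesis by (simp add: lists_length_0)
  next
    case (Suc m)
    then have "{xs. set xs \<subseteq> {} \<and> length xs = n} = ({} :: 'a list set)" by auto
    then show ?thesis by (simp only: sum.empty) simp
  qed
next
  case (insert a S)
  define f where "f i m = sqrt ((m * p i) ^ m)" for i and m :: nat
  have "(\<Sum>xs | set xs \<subseteq> insert a S \<and> length xs = n. \<Prod>i\<in>insert a S. f i (count_list xs i))
    = (\<Sum>m\<le>n. (n choose m) * (f a m *
        (\<Sum>xs | set xs \<subseteq> S \<and> length xs = n - m. \<Prod>i\<in>S. f i (count_list xs i))))"
    using insert by (intro sum_lists_prod_count_insert)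
  also have "\<dots> \<le> (\<Sum>m\<le>n. (n choose m) * (f a m *
        (9 ^ card S * sqrt ((real (n - m) * sum p S) ^ (n - m)))))"
    using insert.IH insert.prems
    by (intro sum_mono mult_left_mono) (auto simp: f_def simp flip: of_nat_diff)
  also have "\<dots> = 9 ^ card S * (\<Sum>m\<le>n. (n choose m) * (sqrt ((m * p a) ^ m)
      * sqrt ((real (n - m) * sum p S) ^ (n - m))))"
    unfolding sum_distrib_left by (intro sum.cong) (auto simp: f_def of_nat_diff)
  also have "\<dots> \<le> 9 ^ card S * (9 * sqrt ((n * (p a + sum p S)) ^ n))"
    using insert.prems by (intro mult_left_mono sum_binomial_sqrt_weights sum_nonneg) auto
  also have "\<dots> = 9 ^ card (insert a S) * sqrt ((n * sum p (insert a S)) ^ n)"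
    using insert.hyps by simp
  finally show ?case
    by (simp add: f_def)
qed

section \<open>The law of an i.i.d. sample\<close>

lemma finite_lists_over: "finite S \<Longrightarrow> finite {xs. set xs \<subseteq> S \<and> length xs = n}"
  by (rule finite_lists_length_eq)

lemma pmf_replicate_pmf:
  "length xs = n \<Longrightarrow> pmf (replicate_pmf n p) xs = prod_list (map (pmf p) xs)"
proof (induction n arbitrary: xs)
  case 0
  then show ?case by simp
next
  case (Suc n)
  then obtain y ys where xs: "xs = y # ys" "length ys = n"
    by (auto simp: length_Suc_conv)
  have "replicate_pmf (Suc n) p = map_pmf (\<lambda>(x, xs). x # xs) (pair_pmf p (replicate_pmf n p))"
    by (simp add: pair_pmf_def map_bind_pmf bind_assoc_pmf bind_return_pmf map_pmf_def)
  moreover have "inj (\<lambda>(x, xs). x # xs :: 'a list)"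
    by (auto simp: inj_def)
  ultimately have "pmf (replicate_pmf (Suc n) p) xs = pmf (pair_pmf p (replicate_pmf n p)) (y, ys)"
    using pmf_map_inj'[of "\<lambda>(x, xs). x # xs" "pair_pmf p (replicate_pmf n p)" "(y, ys)"] xs by simp
  then show ?case
    using Suc.IH xs by (simp add: pmf_pair)
qed

lemma prod_list_map_eq_prod_count:
  fixes f :: "'a \<Rightarrow> 'b :: comm_monoid_mult"
  assumes "finite S" "set xs \<subseteq> S"
  shows "prod_list (map f xs) = (\<Prod>i\<in>S. f i ^ count_list xs i)"
  using assms(2)
proof (induction xs)
  case Nil
  then show ?case by simp
next
  case (Cons x xs)
  have "(\<Prod>i\<in>S. f i ^ count_list (x # xs) i)
      = (\<Prod>i\<in>S. (if i = x then f i else 1) * f i ^ count_list xs i)"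
    by (intro prod.cong) auto
  also have "\<dots> = f x * (\<Prod>i\<in>S. f i ^ count_list xs i)"
    using assms(1) Cons.prems by (simp add: prod.distrib)
  finally show ?case
    using Cons by simp
qed

lemma measure_replicate_pmf:
  assumes "p \<in> prob_simplex k"
  shows "measure_pmf.prob (replicate_pmf n p) B
    = (\<Sum>xs | (set xs \<subseteq> {1..k} \<and> length xs = n) \<and> xs \<in> B. pmf (replicate_pmf n p) xs)"
proof -
  let ?W = "{xs. set xs \<subseteq> {1..k} \<and> length xs = n}"
  have "set_pmf (replicate_pmf n p) \<subseteq> ?W"
    using assms by (auto simp: set_replicate_pmf prob_simplex_def)
  then have "B \<inter> set_pmf (replicate_pmf n p) = (?W \<inter> B) \<inter> set_pmf (replicate_pmf n p)"
    by auto
  then have "measure_pmf.prob (replicate_pmf n p) B = measure_pmf.prob (replicate_pmf n p) (?W \<inter> B)"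
    by (metis measure_Int_set_pmf)
  also have "\<dots> = (\<Sum>xs\<in>?W \<inter> B. pmf (replicate_pmf n p) xs)"
    by (simp add: measure_measure_pmf_finite finite_lists_over)
  also have "?W \<inter> B = {xs. (set xs \<subseteq> {1..k} \<and> length xs = n) \<and> xs \<in> B}"
    by auto
  finally show ?thesis .
qed

lemma sum_pmf_prob_simplex: "p \<in> prob_simplex k \<Longrightarrow> (\<Sum>i\<in>{1..k}. pmf p i) = 1"
  by (intro sum_pmf_eq_1) (auto simp: prob_simplex_def)

section \<open>Tail bound for the divergence of the empirical distribution\<close>

text \<open>A kernel must be defined on all lists; the default \<open>return_pmf 1\<close> keeps the
  value in the simplex for \<open>k \<ge> 1\<close>.\<close>

definition empirical :: "nat \<Rightarrow> nat list \<Rightarrow> nat pmf" where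
  "empirical k xs = (if xs \<noteq> [] \<and> set xs \<subseteq> {1..k} then pmf_of_multiset (mset xs) else return_pmf 1)"

lemma empirical_in_prob_simplex: "1 \<le> k \<Longrightarrow> empirical k xs \<in> prob_simplex k"
  by (auto simp: empirical_def prob_simplex_def)

lemma pmf_empirical:
  assumes "xs \<noteq> []" "set xs \<subseteq> {1..k}"
  shows "pmf (empirical k xs) i = count_list xs i / length xs"
  using assms by (simp add: empirical_def count_mset)

lemma KL_eq_sum:
  assumes "\<And>i. i \<in> {1..k} \<Longrightarrow> pmf q i \<noteq> 0 \<Longrightarrow> pmf p i \<noteq> 0"
  shows "KL k q p = ereal (\<Sum>i\<in>{1..k}. pmf q i * ln (pmf q i / pmf p i))"
proof -
  have "KL k q p = (\<Sum>i\<in>{1..k}. ereal (pmf q i * ln (pmf q i / pmf p i)))"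
    unfolding KL_def using assms by (intro sum.cong) auto
  then show ?thesis by simp
qed

lemma sqrt_prod: "sqrt (\<Prod>i\<in>S. f i) = (\<Prod>i\<in>S. sqrt (f i))"
  by (induction S rule: infinite_finite_induct) (auto simp: real_sqrt_mult)

text \<open>The exponential Markov inequality for a single word. For a word of likelihood
  \<open>P > 0\<close>, the right-hand side is \<open>P * exp (n * (KL - \<epsilon>) / 2)\<close>,
  because \<open>exp (n * KL) = M / (n ^ n * P)\<close> with \<open>M\<close> the product of the
  \<open>c i ^ c i\<close>.\<close>

lemma pmf_replicate_le_of_KL_empirical:
  assumes p: "p \<in> prob_simplex k" and n: "0 < n"
    and xs: "set xs \<subseteq> {1..k}" "length xs = n"
    and KL: "\<not> KL k (empirical k xs) p \<le> ereal \<epsilon>"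
  shows "pmf (replicate_pmf n p) xs \<le> exp (- (real n * \<epsilon> / 2)) / sqrt (real n ^ n)
    * (\<Prod>i\<in>{1..k}. sqrt ((count_list xs i * pmf p i) ^ count_list xs i))"
proof (cases "pmf (replicate_pmf n p) xs = 0")
  case True
  have "0 \<le> exp (- (real n * \<epsilon> / 2)) / sqrt (real n ^ n)
      * (\<Prod>i\<in>{1..k}. sqrt ((count_list xs i * pmf p i) ^ count_list xs i))"
    by (intro mult_nonneg_nonneg divide_nonneg_nonneg prod_nonneg) auto
  with True show ?thesis by simp
next
  case False
  define c where "c = count_list xs"
  define P where "P = (\<Prod>i\<in>{1..k}. pmf p i ^ c i)"
  define M where "M = (\<Prod>i\<in>{1..k}. real (c i) ^ c i)"
  have P: "pmf (replicate_pmf n p) xs = P"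
    using xs by (simp add: pmf_replicate_pmf prod_list_map_eq_prod_count[of "{1..k}"] P_def c_def)
  have P_pos: "0 < P"
    using False P pmf_nonneg[of "replicate_pmf n p" xs] by linarith
  have ac: "pmf p i > 0" if "i \<in> {1..k}" "c i \<noteq> 0" for i
  proof -
    have "pmf p i ^ c i \<noteq> 0"
      using P_pos that unfolding P_def by (metis finite_atLeastAtMost less_irrefl prod_zero_iff)
    then show ?thesis
      using that by (simp add: pmf_pos)
  qed
  have sum_c: "sum c {1..k} = n"
    using sum_count_set[of xs "{1..k}"] xs by (simp add: c_def)
  have q: "pmf (empirical k xs) i = c i / n" for i
    using xs n by (subst pmf_empirical) (auto simp: c_def)
  have "KL k (empirical k xs) p = ereal (\<Sum>i\<in>{1..k}. c i / n * ln (c i / n / pmf p i))"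
    using ac n by (subst KL_eq_sum) (auto simp: q less_imp_neq[symmetric])
  with KL have "\<epsilon> < (\<Sum>i\<in>{1..k}. c i / n * ln (c i / n / pmf p i))"
    by simp
  then have "real n * \<epsilon> < n * (\<Sum>i\<in>{1..k}. c i / n * ln (c i / n / pmf p i))"
    using n by simp
  also have "\<dots> = (\<Sum>i\<in>{1..k}. c i * ln (c i / n / pmf p i))"
    using n by (simp add: sum_distrib_left)
  finally have "exp (real n * \<epsilon>) \<le> exp (\<Sum>i\<in>{1..k}. c i * ln (c i / n / pmf p i))"
    by simp
  also have "\<dots> = (\<Prod>i\<in>{1..k}. (c i / n / pmf p i) ^ c i)"
    unfolding exp_sum[OF finite_atLeastAtMost]
  proof (intro prod.cong refl)
    fix i assume "i \<in> {1..k}"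
    then show "exp (c i * ln (c i / n / pmf p i)) = (c i / n / pmf p i) ^ c i"
      using ac[of i] n by (cases "c i = 0") (auto simp: exp_of_nat_mult)
  qed
  also have "\<dots> = M / (real n ^ n * P)"
  proof -
    have "real n ^ n = (\<Prod>i\<in>{1..k}. real n ^ c i)"
      by (simp only: sum_c flip: power_sum)
    then show ?thesis
      unfolding M_def P_def
      by (simp only: power_divide divide_divide_eq_left power_mult_distrib flip: prod.distrib prod_dividef)
  qed
  finally have "exp (real n * \<epsilon>) * (real n ^ n * P) \<le> M"
    using n P_pos by (simp add: pos_le_divide_eq)
  \<comment> \<open>The extra factor \<open>P\<close> makes the left side a square, and
    \<open>M * P\<close> still factors over the letters.\<close>
  then have "exp (real n * \<epsilon>) * (real n ^ n * P) * P \<le> M * P"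
    using P_pos by (intro mult_right_mono) auto
  then have "(exp (real n * \<epsilon> / 2) * sqrt (real n ^ n) * P)\<^sup>2 \<le> M * P"
    by (simp add: power_mult_distrib power2_eq_square[of P] mult_ac flip: exp_double)
  then have "exp (real n * \<epsilon> / 2) * sqrt (real n ^ n) * P \<le> sqrt (M * P)"
    by (rule real_le_rsqrt)
  then have "P \<le> exp (- (real n * \<epsilon> / 2)) / sqrt (real n ^ n) * sqrt (M * P)"
    using n by (simp add: exp_minus field_simps)
  also have "sqrt (M * P) = (\<Prod>i\<in>{1..k}. sqrt ((c i * pmf p i) ^ c i))"
    unfolding M_def P_def
    by (simp add: power_mult_distrib prod.distrib flip: sqrt_prod)
  finally show ?thesis
    by (simp add: P c_def)
qed

text \<open>The pointwise bound is summed over all words instead of the bad ones only. Since the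
  weights \<open>pmf p i\<close> sum to 1, the two factors \<open>sqrt (n ^ n)\<close>
  cancel.\<close>

lemma prob_KL_empirical:
  assumes p: "p \<in> prob_simplex k" and n: "0 < n"
  shows "measure_pmf.prob (replicate_pmf n p) {xs. \<not> KL k (empirical k xs) p \<le> ereal \<epsilon>}
    \<le> 9 ^ k * exp (- (real n * \<epsilon> / 2))"
proof -
  let ?W = "{xs. set xs \<subseteq> {1..k} \<and> length xs = n}"
  let ?g = "\<lambda>xs. \<Prod>i\<in>{1..k}. sqrt ((count_list xs i * pmf p i) ^ count_list xs i)"
  let ?c = "exp (- (real n * \<epsilon> / 2)) / sqrt (real n ^ n)"
  have "measure_pmf.prob (replicate_pmf n p) {xs. \<not> KL k (empirical k xs) p \<le> ereal \<epsilon>}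
      \<le> (\<Sum>xs | (set xs \<subseteq> {1..k} \<and> length xs = n)
          \<and> xs \<in> {xs. \<not> KL k (empirical k xs) p \<le> ereal \<epsilon>}. ?c * ?g xs)"
    unfolding measure_replicate_pmf[OF p]
    by (intro sum_mono pmf_replicate_le_of_KL_empirical p n) auto
  also have "\<dots> \<le> (\<Sum>xs\<in>?W. ?c * ?g xs)"
    by (intro sum_mono2 finite_lists_over mult_nonneg_nonneg divide_nonneg_nonneg prod_nonneg) auto
  also have "\<dots> = ?c * (\<Sum>xs\<in>?W. ?g xs)"
    by (simp add: sum_distrib_left)
  also have "\<dots> \<le> ?c * (9 ^ card {1..k} * sqrt ((n * sum (pmf p) {1..k}) ^ n))"
    by (intro mult_left_mono sum_lists_sqrt_weights) auto
  also have "\<dots> = 9 ^ k * exp (- (real n * \<epsilon> / 2))"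
    using n by (simp add: sum_pmf_prob_simplex[OF p, simplified])
  finally show ?thesis .
qed

text \<open>A deterministic estimator is the kernel of point masses \<open>return\<close>, so its
  failure probability is that of the bad samples.\<close>

lemma learnable_KL:
  assumes k: "1 \<le> k" and n: "0 < n" and \<delta>: "9 ^ k * exp (- (real n * \<epsilon> / 2)) \<le> \<delta>"
  shows "learnable (KL k) k \<epsilon> \<delta> n"
  unfolding learnable_def
proof (intro bexI ballI)
  let ?N = "simplex_space k"
  let ?A = "\<lambda>xs. return ?N (empirical k xs)"
  show "?A \<in> count_space UNIV \<rightarrow>\<^sub>M prob_algebra ?N"
    by (intro measurable_prob_algebraI)
      (auto simp: prob_space_return empirical_in_prob_simplex[OF k] space_subprob_algebra
        intro: prob_space_imp_subprob_space)
  fix p assume p: "p \<in> prob_simplex k"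
  let ?R = "replicate_pmf n p" and ?B = "{q \<in> prob_simplex k. KL k q p \<le> ereal \<epsilon>}"
  have meas: "empirical k \<in> measure_pmf ?R \<rightarrow>\<^sub>M ?N"
    by (simp add: empirical_in_prob_simplex[OF k])
  have "measure (measure_pmf ?R \<bind> ?A) ?B = measure (distr ?R ?N (empirical k)) ?B"
    using meas by (subst bind_return_distr') auto
  also have "\<dots> = measure_pmf.prob ?R {xs. KL k (empirical k xs) p \<le> ereal \<epsilon>}"
    using meas KL_ball_in_sets[of k p \<epsilon>]
    by (subst measure_distr) (auto simp: empirical_in_prob_simplex[OF k] intro!: arg_cong[of _ _ "measure_pmf.prob ?R"])
  also have "\<dots> = 1 - measure_pmf.prob ?R {xs. \<not> KL k (empirical k xs) p \<le> ereal \<epsilon>}"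
    by (subst measure_pmf.prob_compl[symmetric]) (auto intro!: arg_cong[of _ _ "measure_pmf.prob ?R"])
  also have "\<dots> \<ge> 1 - \<delta>"
    using prob_KL_empirical[OF p n, of \<epsilon>] \<delta> by simp
  finally show "1 - \<delta> \<le> measure (measure_pmf ?R \<bind> ?A) ?B" .
qed

section \<open>Lower bounds\<close>

text \<open>Only finitely many samples can occur, so the mixture is a finite sum. This reduces the
  kernel to a family of probability measures indexed by words.\<close>

lemma learnableE:
  assumes "learnable (KL k) k \<epsilon> \<delta> n"
  obtains A where "\<And>xs. prob_space (A xs)" "\<And>xs. sets (A xs) = sets (simplex_space k)"
    "\<And>p. p \<in> prob_simplex k \<Longrightarrow>
      1 - \<delta> \<le> (\<Sum>xs | set xs \<subseteq> {1..k} \<and> length xs = n.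
        pmf (replicate_pmf n p) xs * measure (A xs) {q \<in> prob_simplex k. KL k q p \<le> ereal \<epsilon>})"
proof -
  let ?N = "simplex_space k"
  let ?W = "{xs. set xs \<subseteq> {1..k} \<and> length xs = n}"
  obtain A where A: "A \<in> count_space UNIV \<rightarrow>\<^sub>M prob_algebra ?N"
    and succ: "\<And>p. p \<in> prob_simplex k \<Longrightarrow> 1 - \<delta>
      \<le> measure (measure_pmf (replicate_pmf n p) \<bind> A) {q \<in> prob_simplex k. KL k q p \<le> ereal \<epsilon>}"
    using assms by (auto simp: learnable_def)
  have A_space: "A xs \<in> space (prob_algebra ?N)" for xs
    using measurable_space[OF A] by simp
  have "1 - \<delta> \<le> (\<Sum>xs\<in>?W. pmf (replicate_pmf n p) xs
      * measure (A xs) {q \<in> prob_simplex k. KL k q p \<le> ereal \<epsilon>})" if p: "p \<in> prob_simplex k" for p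
  proof -
    let ?R = "replicate_pmf n p" and ?B = "{q \<in> prob_simplex k. KL k q p \<le> ereal \<epsilon>}"
    have "A \<in> measure_pmf ?R \<rightarrow>\<^sub>M subprob_algebra ?N"
      using measurable_prob_algebraD[OF A] by simp
    then have "measure (measure_pmf ?R \<bind> A) ?B = (\<integral>xs. measure (A xs) ?B \<partial>measure_pmf ?R)"
      using KL_ball_in_sets by (rule measure_pmf.measure_bind)
    also have "\<dots> = (\<Sum>xs\<in>?W. pmf ?R xs *\<^sub>R measure (A xs) ?B)"
      using p by (intro integral_measure_pmf finite_lists_over)
        (auto simp: set_replicate_pmf prob_simplex_def)
    finally show ?thesis
      using succ[OF p] by simp
  qed
  with A_space show thesis
    by (intro that[of A]) (auto simp: space_prob_algebra)
qed

section \<open>Outputs of small divergence\<close>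

lemma KL_le_imp_set_pmf_subset:
  assumes q: "q \<in> prob_simplex k" and KL: "KL k q p \<le> ereal \<epsilon>"
  shows "set_pmf q \<subseteq> set_pmf p"
proof
  fix i assume i: "i \<in> set_pmf q"
  show "i \<in> set_pmf p"
  proof (rule ccontr)
    assume "i \<notin> set_pmf p"
    with i q have "KL k q p = \<infinity>"
      unfolding KL_def
      by (subst sum_Pinfty) (auto simp: set_pmf_iff prob_simplex_def intro!: bexI[of _ i])
    with KL show False by simp
  qed
qed

text \<open>From \<open>ln x \<le> x - 1\<close> one gets \<open>q * ln (q / p) \<ge> q - p\<close>
  at each point of the support of \<open>q\<close>; summation leaves the mass that \<open>p\<close>
  puts outside this support.\<close>

lemma KL_ge_uncovered_mass:
  assumes q: "q \<in> prob_simplex k" and T: "set_pmf q \<subseteq> T" "finite T"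
  shows "ereal (1 - sum (pmf p) T) \<le> KL k q p"
proof (cases "set_pmf q \<subseteq> set_pmf p")
  case False
  then have "\<not> KL k q p \<le> ereal \<epsilon>" for \<epsilon>
    using KL_le_imp_set_pmf_subset[OF q] by blast
  then show ?thesis
    using nle_le by blast
next
  case True
  have KL: "KL k q p = ereal (\<Sum>i\<in>{1..k}. pmf q i * ln (pmf q i / pmf p i))"
    using True by (intro KL_eq_sum) (auto simp: set_pmf_iff)
  have "sum (pmf p) (set_pmf q) \<le> sum (pmf p) T"
    using T by (intro sum_mono2) auto
  moreover have "sum (pmf p) (set_pmf q) = (\<Sum>i\<in>{1..k}. if i \<in> set_pmf q then pmf p i else 0)"
    using q by (subst sum.inter_restrict[symmetric]) (auto simp: prob_simplex_def Int_absorb1)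
  ultimately have "1 - sum (pmf p) T
      \<le> (\<Sum>i\<in>{1..k}. pmf q i - (if i \<in> set_pmf q then pmf p i else 0))"
    by (simp only: sum_subtractf sum_pmf_prob_simplex[OF q])
  also have "\<dots> \<le> (\<Sum>i\<in>{1..k}. pmf q i * ln (pmf q i / pmf p i))"
  proof (intro sum_mono)
    fix i
    show "pmf q i - (if i \<in> set_pmf q then pmf p i else 0) \<le> pmf q i * ln (pmf q i / pmf p i)"
    proof (cases "i \<in> set_pmf q")
      case False
      then show ?thesis by (simp add: set_pmf_iff)
    next
      case i: True
      then have pos: "0 < pmf q i" "0 < pmf p i"
        using True by (auto intro: pmf_positive)
      then have "- ln (pmf q i / pmf p i) \<le> pmf p i / pmf q i - 1"
        using ln_le_minus_one[of "pmf p i / pmf q i"] by (simp add: ln_div)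
      then have "pmf q i * (1 - pmf p i / pmf q i) \<le> pmf q i * ln (pmf q i / pmf p i)"
        using pos by (intro mult_left_mono) auto
      then show ?thesis
        using i pos by (simp add: algebra_simps)
    qed
  qed
  finally show ?thesis
    by (simp add: KL)
qed

section \<open>The hard distributions and the bound by the error probability\<close>

definition spike :: "nat set \<Rightarrow> real \<Rightarrow> nat pmf" where
  "spike S t = embed_pmf (\<lambda>i. if i \<in> S then t else if i = 1 then 1 - real (card S) * t else 0)"

lemma pmf_spike:
  assumes "finite S" "1 \<notin> S" "0 \<le> t" "real (card S) * t \<le> 1"
  shows "pmf (spike S t) i = (if i \<in> S then t else if i = 1 then 1 - real (card S) * t else 0)"
  unfolding spike_def
proof (rule pmf_embed_pmf)
  let ?f = "\<lambda>i. if i \<in> S then t else if i = 1 then 1 - real (card S) * t else 0"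
  show nn: "0 \<le> ?f i" for i
    using assms by simp
  have "(\<integral>\<^sup>+ i. ennreal (?f i) \<partial>count_space UNIV) = (\<Sum>i\<in>insert 1 S. ennreal (?f i))"
    using assms by (intro nn_integral_count_space') auto
  also have "\<dots> = ennreal (\<Sum>i\<in>insert 1 S. ?f i)"
    using nn by (intro sum_ennreal)
  also have "(\<Sum>i\<in>insert 1 S. ?f i) = 1"
    using assms by simp
  finally show "(\<integral>\<^sup>+ i. ennreal (?f i) \<partial>count_space UNIV) = 1"
    by simp
qed

lemma spike_in_prob_simplex:
  assumes "S \<subseteq> {2..k}" "0 \<le> t" "real (card S) * t \<le> 1" "1 \<le> k"
  shows "spike S t \<in> prob_simplex k"
proof -
  have "finite S" "1 \<notin> S"
    using assms finite_subset by auto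
  then show ?thesis
    using assms by (auto simp: prob_simplex_def set_pmf_iff pmf_spike split: if_splits)
qed

text \<open>A point mass must be output exactly when its support is the only point sampled, whereas a
  tiny extra atom makes this output wrong and is missed by all samples with probability
  exponentially small in \<open>n * \<epsilon>\<close>.\<close>

lemma learnable_KL_ge_ln:
  assumes L: "learnable (KL k) k \<epsilon> \<delta> n"
    and k: "2 \<le> k" and \<epsilon>: "0 < \<epsilon>" "\<epsilon> \<le> 1 / 4" and \<delta>: "0 < \<delta>" "\<delta> \<le> 1 / 8"
  shows "ln (1 / \<delta>) / (8 * \<epsilon>) \<le> n"
proof -
  let ?W = "{xs. set xs \<subseteq> {1..k} \<and> length xs = n}"
  obtain A where A: "\<And>xs. prob_space (A xs)" "\<And>xs. sets (A xs) = sets (simplex_space k)"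
    and succ: "\<And>p. p \<in> prob_simplex k \<Longrightarrow> 1 - \<delta> \<le> (\<Sum>xs\<in>?W.
        pmf (replicate_pmf n p) xs * measure (A xs) {q \<in> prob_simplex k. KL k q p \<le> ereal \<epsilon>})"
    by (rule learnableE[OF L]) blast
  define p0 where "p0 = spike {} 0"
  define p1 where "p1 = spike {2} (2 * \<epsilon>)"
  define E where "E p = {q \<in> prob_simplex k. KL k q p \<le> ereal \<epsilon>}" for p
  define ones where "ones = replicate n (1::nat)"
  have p0: "p0 \<in> prob_simplex k" "pmf p0 i = (if i = 1 then 1 else 0)" for i
    using k unfolding p0_def by (auto intro!: spike_in_prob_simplex simp: pmf_spike)
  have p1: "p1 \<in> prob_simplex k" "pmf p1 1 = 1 - 2 * \<epsilon>"
    using k \<epsilon> unfolding p1_def by (auto intro!: spike_in_prob_simplex simp: pmf_spike)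
  have ones: "ones \<in> ?W" "length ones = n"
    using k by (auto simp: ones_def)
  have fin: "finite ?W"
    by (rule finite_lists_over) simp
  have le_1: "measure (A xs) B \<le> 1" for xs B
    using prob_space.prob_le_1[OF A(1)] .
  have sum_1: "(\<Sum>xs\<in>?W. pmf (replicate_pmf n p) xs) = 1" if "p \<in> prob_simplex k" for p
    using that by (intro sum_pmf_eq_1 fin) (auto simp: set_replicate_pmf prob_simplex_def)
  \<comment> \<open>Under \<open>p0\<close> only the constant word occurs, so success for
    \<open>p0\<close> concerns the single measure \<open>A ones\<close>.\<close>
  have "pmf (replicate_pmf n p0) xs = 0" if "xs \<in> ?W - {ones}" for xs
  proof -
    have "xs \<noteq> ones" "length xs = n"
      using that by auto
    then obtain x where "x \<in> set xs" "x \<noteq> 1"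
      unfolding ones_def by (metis replicate_eqI)
    then show ?thesis
      using \<open>length xs = n\<close> by (auto simp: pmf_replicate_pmf prod_list_zero_iff image_iff p0(2) intro!: bexI[of _ x])
  qed
  then have "(\<Sum>xs\<in>?W. pmf (replicate_pmf n p0) xs * measure (A xs) (E p0))
      = (\<Sum>xs\<in>{ones}. pmf (replicate_pmf n p0) xs * measure (A xs) (E p0))"
    using ones fin by (intro sum.mono_neutral_right) auto
  also have "\<dots> \<le> measure (A ones) (E p0)"
    by (simp add: mult_left_le_one_le pmf_le_1)
  finally have E0: "1 - \<delta> \<le> measure (A ones) (E p0)"
    using succ[OF p0(1)] by (simp add: E_def)
  \<comment> \<open>An output accurate for \<open>p0\<close> charges only 1 and misses the mass
    \<open>2 * \<epsilon>\<close> that \<open>p1\<close> puts on 2, which forces a divergence above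
    \<open>\<epsilon>\<close>.\<close>
  have disj: "E p0 \<inter> E p1 = {}"
  proof -
    have False if q: "q \<in> prob_simplex k" "KL k q p0 \<le> ereal \<epsilon>" "KL k q p1 \<le> ereal \<epsilon>" for q
    proof -
      have "set_pmf q \<subseteq> {1}"
        using KL_le_imp_set_pmf_subset[OF q(1,2)] by (auto simp: set_pmf_iff p0(2) split: if_splits)
      then have "ereal (2 * \<epsilon>) \<le> KL k q p1"
        using KL_ge_uncovered_mass[OF q(1), of "{1}" p1] p1 by simp
      also have "\<dots> \<le> ereal \<epsilon>" by fact
      finally show False using \<epsilon> by simp
    qed
    then show ?thesis by (auto simp: E_def)
  qed
  have "measure (A ones) (E p0) + measure (A ones) (E p1) = measure (A ones) (E p0 \<union> E p1)"
    using disj A KL_ball_in_sets unfolding E_def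
    by (intro finite_measure.finite_measure_Union[symmetric] prob_space.finite_measure) auto
  with E0 have E1: "measure (A ones) (E p1) \<le> \<delta>"
    using le_1[of ones "E p0 \<union> E p1"] by simp
  have pr: "pmf (replicate_pmf n p1) ones = (1 - 2 * \<epsilon>) ^ n"
    using p1(2) ones(2) by (simp add: pmf_replicate_pmf ones_def)
  \<comment> \<open>On the constant word success for \<open>p1\<close> has probability at most
    \<open>\<delta>\<close>; on every other word it is bounded by 1.\<close>
  have "1 - \<delta> \<le> (\<Sum>xs\<in>?W. pmf (replicate_pmf n p1) xs * measure (A xs) (E p1))"
    using succ[OF p1(1)] by (simp add: E_def)
  also have "\<dots> = pmf (replicate_pmf n p1) ones * measure (A ones) (E p1)
      + (\<Sum>xs\<in>?W - {ones}. pmf (replicate_pmf n p1) xs * measure (A xs) (E p1))"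
    using ones fin by (subst sum.remove[of _ ones]) auto
  also have "\<dots> \<le> pmf (replicate_pmf n p1) ones * \<delta> + (\<Sum>xs\<in>?W - {ones}. pmf (replicate_pmf n p1) xs * 1)"
    using E1 le_1 by (intro add_mono sum_mono mult_left_mono) auto
  also have "(\<Sum>xs\<in>?W - {ones}. pmf (replicate_pmf n p1) xs * 1) = 1 - pmf (replicate_pmf n p1) ones"
    using sum_1[OF p1(1)] ones fin by (simp add: sum_diff1)
  finally have main: "(1 - 2 * \<epsilon>) ^ n * (1 - \<delta>) \<le> \<delta>"
    by (simp add: pr algebra_simps)
  \<comment> \<open>The bound \<open>ln (1 - x) \<ge> - x - 2 * x\<^sup>2\<close> at
    \<open>x = 2 * \<epsilon>\<close>; it needs \<open>x \<le> 1 / 2\<close>, and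
    \<open>8 * \<epsilon> * \<epsilon> \<le> 2 * \<epsilon>\<close> also follows from
    \<open>\<epsilon> \<le> 1 / 4\<close>.\<close>
  have "- (4 * \<epsilon>) \<le> - (2 * \<epsilon>) - 2 * (2 * \<epsilon>)\<^sup>2"
    using \<epsilon> by (simp add: power2_eq_square)
  also have "\<dots> \<le> ln (1 - 2 * \<epsilon>)"
    using \<epsilon> by (intro ln_one_minus_pos_lower_bound) auto
  finally have "exp (- (4 * \<epsilon>)) \<le> 1 - 2 * \<epsilon>"
    using \<epsilon> by (subst (asm) ln_ge_iff) auto
  then have "exp (- (4 * \<epsilon>)) ^ n \<le> (1 - 2 * \<epsilon>) ^ n"
    by (intro power_mono) auto
  then have e: "exp (- (4 * \<epsilon> * n)) \<le> (1 - 2 * \<epsilon>) ^ n"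
    by (simp add: mult_ac flip: exp_of_nat_mult)
  show ?thesis
  proof (rule ccontr)
    assume "\<not> ?thesis"
    \<comment> \<open>With so few samples the constant word has probability above
      \<open>sqrt \<delta>\<close> under \<open>p1\<close>. Then \<open>main\<close> gives
      \<open>1 - \<delta> < sqrt \<delta>\<close>, impossible for
      \<open>\<delta> \<le> 1 / 8\<close>.\<close>
    then have "8 * \<epsilon> * n < ln (1 / \<delta>)"
      using \<epsilon> by (simp add: field_simps)
    then have "ln \<delta> / 2 < - (4 * \<epsilon> * n)"
      using \<delta> by (simp add: ln_div)
    then have "exp (ln \<delta> / 2) < exp (- (4 * \<epsilon> * n))"
      by (subst exp_less_cancel_iff)
    then have "exp (ln \<delta> / 2) < (1 - 2 * \<epsilon>) ^ n"
      using e by (rule less_le_trans)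
    moreover have s: "exp (ln \<delta> / 2) = sqrt \<delta>"
    proof -
      have "exp (ln \<delta> / 2) ^ 2 = \<delta>"
        using \<delta> by (simp flip: exp_double)
      then show ?thesis
        by (metis exp_ge_zero real_sqrt_unique)
    qed
    ultimately have "sqrt \<delta> * (1 - \<delta>) < (1 - 2 * \<epsilon>) ^ n * (1 - \<delta>)"
      using \<delta> by (intro mult_strict_right_mono) auto
    also note main
    also have "\<delta> = sqrt \<delta> * sqrt \<delta>"
      using \<delta> by simp
    finally have "sqrt \<delta> * (1 - \<delta>) < sqrt \<delta> * sqrt \<delta>" .
    then have "1 - \<delta> < sqrt \<delta>"
      using \<delta> by (subst (asm) mult_less_cancel_left_pos) auto
    moreover have "sqrt \<delta> \<le> 1 / 2"
      using \<delta> by (intro real_le_lsqrt) (auto simp: power2_eq_square)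
    ultimately show False
      using \<delta> by simp
  qed
qed

section \<open>Averaging over the unknown set\<close>

text \<open>Linearity of expectation: for a probability vector \<open>f\<close>, the left side is
  the mean number of letters satisfying \<open>Q\<close> in an i.i.d. word.\<close>

lemma sum_prod_list_length_filter:
  fixes f :: "'a \<Rightarrow> real"
  assumes S: "finite S" and f: "sum f S = 1"
  shows "(\<Sum>xs | set xs \<subseteq> S \<and> length xs = n. prod_list (map f xs) * length (filter Q xs))
    = n * (\<Sum>x | x \<in> S \<and> Q x. f x)"
proof (induction n)
  case 0
  then show ?case by (simp add: lists_length_0 del: length_0_conv)
next
  case (Suc n)
  let ?W = "\<lambda>n. {xs. set xs \<subseteq> S \<and> length xs = n}"
  have total: "(\<Sum>xs\<in>?W n. prod_list (map f xs)) = 1" for n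
  proof (induction n)
    case 0
    show ?case by (simp add: lists_length_0 del: length_0_conv)
  next
    case (Suc n)
    then show ?case
      by (simp add: sum_lists_Suc S f flip: sum_distrib_left)
  qed
  have "(\<Sum>xs\<in>?W (Suc n). prod_list (map f xs) * length (filter Q xs))
      = (\<Sum>x\<in>S. \<Sum>xs\<in>?W n. f x * (prod_list (map f xs) * length (filter Q xs))
          + f x * (if Q x then 1 else 0) * prod_list (map f xs))"
    unfolding sum_lists_Suc[OF S] by (intro sum.cong refl) (auto simp: algebra_simps)
  also have "\<dots> = (\<Sum>x\<in>S. f x * (n * (\<Sum>x | x \<in> S \<and> Q x. f x)) + f x * (if Q x then 1 else 0))"
    by (simp only: sum.distrib Suc.IH total mult_1_right flip: sum_distrib_left)
  also have "\<dots> = n * (\<Sum>x | x \<in> S \<and> Q x. f x) + (\<Sum>x\<in>S. if Q x then f x else 0)"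
    by (simp add: sum.distrib f flip: sum_distrib_right) (intro sum.cong, auto)
  also have "(\<Sum>x\<in>S. if Q x then f x else 0) = (\<Sum>x | x \<in> S \<and> Q x. f x)"
    by (simp only: sum.inter_filter[OF S])
  finally show ?case
    by (simp add: algebra_simps)
qed

text \<open>Of a set and its complement, at least one contains half of the points.\<close>

lemma card_large_subsets:
  assumes "finite X"
  shows "2 ^ card X \<le> 2 * card {S. S \<subseteq> X \<and> card X \<le> 2 * card S}"
proof -
  let ?H = "{S. S \<subseteq> X \<and> card X \<le> 2 * card S}"
  have "Pow X \<subseteq> ?H \<union> (\<lambda>S. X - S) ` ?H"
  proof
    fix S assume S: "S \<in> Pow X"
    show "S \<in> ?H \<union> (\<lambda>S. X - S) ` ?H"
    proof (cases "card X \<le> 2 * card S")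
      case False
      have "card (X - S) = card X - card S"
        using S assms by (intro card_Diff_subset) (auto intro: finite_subset)
      with False S have "X - S \<in> ?H" "S = X - (X - S)"
        by auto
      then show ?thesis by blast
    qed (use S in auto)
  qed
  moreover have "finite ?H"
    using assms by simp
  ultimately have "card (Pow X) \<le> card ?H + card ((\<lambda>S. X - S) ` ?H)"
    by (meson card_mono card_Un_le finite_UnI finite_imageI order_trans)
  also have "\<dots> \<le> 2 * card ?H"
    using card_image_le[OF \<open>finite ?H\<close>, of "\<lambda>S. X - S"] by simp
  finally show ?thesis
    using assms by (simp add: card_Pow)
qed

text \<open>Integration of the pointwise inequality. It passes from a comparison at each fixed
  output to one for a randomized output.\<close>

lemma (in prob_space) sum_prob_le_of_indicator_le:
  fixes c :: "'i \<Rightarrow> real" and d :: "'j \<Rightarrow> real"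
  assumes fin: "finite I" "finite J"
    and B: "\<And>i. i \<in> I \<Longrightarrow> B i \<in> events" and C: "\<And>j. j \<in> J \<Longrightarrow> C j \<in> events"
    and le: "\<And>x. x \<in> space M \<Longrightarrow> (\<Sum>i\<in>I. c i * indicator (B i) x) \<le> (\<Sum>j\<in>J. d j * indicator (C j) x)"
  shows "(\<Sum>i\<in>I. c i * prob (B i)) \<le> (\<Sum>j\<in>J. d j * prob (C j))"
proof -
  have int: "integrable M (\<lambda>x. a * indicator E x :: real)" if "E \<in> events" for a E
    using that by (intro integrable_mult_right integrable_real_indicator) (auto simp: emeasure_eq_measure)
  have lint: "(\<integral>x. a * indicator E x \<partial>M) = a * prob E" if "E \<in> events" for a E
    using sets.sets_into_space[OF that] by (simp add: Int_absorb2)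
  have "(\<Sum>i\<in>I. c i * prob (B i)) = (\<Sum>i\<in>I. \<integral>x. c i * indicator (B i) x \<partial>M)"
    by (intro sum.cong refl lint[symmetric] B)
  also have "\<dots> = (\<integral>x. (\<Sum>i\<in>I. c i * indicator (B i) x) \<partial>M)"
    by (intro Bochner_Integration.integral_sum[symmetric] int B)
  also have "\<dots> \<le> (\<integral>x. (\<Sum>j\<in>J. d j * indicator (C j) x) \<partial>M)"
    by (intro integral_mono Bochner_Integration.integrable_sum int B C le)
  also have "\<dots> = (\<Sum>j\<in>J. \<integral>x. d j * indicator (C j) x \<partial>M)"
    by (intro Bochner_Integration.integral_sum int C)
  also have "\<dots> = (\<Sum>j\<in>J. d j * prob (C j))"
    by (intro sum.cong refl lint C)
  finally show ?thesis .
qed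

text \<open>Removing \<open>i\<close> from \<open>S\<close> moves its mass to 1, so no point other
  than \<open>i\<close> loses mass, and \<open>i\<close> does not occur in the word.\<close>

lemma pmf_replicate_spike_le_Diff:
  assumes S: "S \<subseteq> {2..k}" and t: "0 \<le> t" "real (card S) * t \<le> 1"
    and xs: "set xs \<subseteq> {1..k}" "length xs = n" "i \<notin> set xs"
  shows "pmf (replicate_pmf n (spike S t)) xs \<le> pmf (replicate_pmf n (spike (S - {i}) t)) xs"
proof -
  have fin: "finite S" "1 \<notin> S"
    using S finite_subset by auto
  have "card (S - {i}) \<le> card S"
    using fin by (intro card_mono) auto
  then have le: "real (card (S - {i})) * t \<le> real (card S) * t"
    using t by (intro mult_right_mono) auto
  have "pmf (spike S t) x \<le> pmf (spike (S - {i}) t) x" if "x \<noteq> i" for x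
    using that fin t le by (auto simp: pmf_spike)
  then have "(\<Prod>x\<in>{1..k}. pmf (spike S t) x ^ count_list xs x)
      \<le> (\<Prod>x\<in>{1..k}. pmf (spike (S - {i}) t) x ^ count_list xs x)"
    using xs(3) by (intro prod_mono) (metis count_notin pmf_nonneg power_0 power_mono zero_le_power order_refl)
  then show ?thesis
    using xs by (simp add: pmf_replicate_pmf prod_list_map_eq_prod_count[of "{1..k}"])
qed

text \<open>If the samples leave much of \<open>S\<close> unseen, a successful output for \<open>spike S t\<close> charges an
  unseen point \<open>i \<in> S\<close>. The same output fails for \<open>spike (S - {i}) t\<close>, under which
  these samples are at least as likely.\<close>

lemma sum_success_le_sum_failure:
  fixes \<epsilon> t :: real and k :: nat
  defines "E \<equiv> (\<lambda>S. {q \<in> prob_simplex k. KL k q (spike S t) \<le> ereal \<epsilon>})"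
  assumes k: "2 \<le> k" and \<epsilon>: "0 < \<epsilon>" and t: "0 < t" "real (k - 1) * t \<le> 1" "\<epsilon> \<le> real (k - 1) * t / 4"
    and xs: "set xs \<subseteq> {1..k}" "length xs = n" and few: "4 * card (set xs - {1}) < k - 1"
    and q: "q \<in> prob_simplex k"
  shows "(\<Sum>S | S \<subseteq> {2..k} \<and> k - 1 \<le> 2 * card S.
        pmf (replicate_pmf n (spike S t)) xs * indicator (E S) q)
    \<le> (\<Sum>S\<in>Pow {2..k}. pmf (replicate_pmf n (spike S t)) xs * indicator (prob_simplex k - E S) q)"
    (is "sum ?l ?H \<le> sum ?r ?P")
proof -
  define T where "T = set xs - {1}"
  have l_nn: "0 \<le> ?l S" and r_nn: "0 \<le> ?r S" for S
    by auto
  have S: "finite S" "1 \<notin> S" "real (card S) * t \<le> 1" if "S \<subseteq> {2..k}" for S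
  proof -
    show "finite S" "1 \<notin> S"
      using that finite_subset by auto
    have "card S \<le> k - 1"
      using card_mono[OF _ that] by simp
    then have "real (card S) * t \<le> real (k - 1) * t"
      using t by (intro mult_right_mono) auto
    with t(2) show "real (card S) * t \<le> 1" by linarith
  qed
  have supp: "set_pmf (spike S t) \<subseteq> insert 1 S" if "S \<subseteq> {2..k}" for S
    using S[OF that] t by (auto simp: set_pmf_iff pmf_spike split: if_splits)
  have in_E: "set_pmf q \<subseteq> insert 1 S" if "q \<in> E S" "S \<subseteq> {2..k}" for S
    using KL_le_imp_set_pmf_subset[OF q, of "spike S t" \<epsilon>] that supp[OF that(2)] by (auto simp: E_def)
  show ?thesis
  proof (cases "set_pmf q \<subseteq> insert 1 T")
    case True
    \<comment> \<open>Here \<open>q\<close> misses all unseen points of \<open>U\<close>. There are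
      more than \<open>(k - 1) / 2 - (k - 1) / 4\<close> of them, with total mass above
      \<open>\<epsilon>\<close>, so \<open>q\<close> cannot succeed for \<open>U\<close>.\<close>
    have "?l U = 0" if U: "U \<in> ?H" for U
    proof (rule ccontr)
      assume nz: "?l U \<noteq> 0"
      then have U': "U \<subseteq> {2..k}" and qE: "q \<in> E U" and px: "pmf (replicate_pmf n (spike U t)) xs \<noteq> 0"
        using U by (auto simp: indicator_def)
      have "set xs \<subseteq> set_pmf (spike U t)"
        using px by (auto simp: set_pmf_iff[symmetric] set_replicate_pmf)
      then have TU: "T \<subseteq> U"
        using supp[OF U'] by (auto simp: T_def)
      have "sum (pmf (spike U t)) (insert 1 T) = 1 - real (card U) * t + real (card T) * t"
      proof -
        have "(\<Sum>x\<in>T. pmf (spike U t) x) = (\<Sum>x\<in>T. t)"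
          using TU S[OF U'] t by (intro sum.cong) (auto simp: pmf_spike)
        moreover have "pmf (spike U t) 1 = 1 - real (card U) * t"
          using S[OF U'] t by (simp add: pmf_spike)
        ultimately show ?thesis
          by (subst sum.insert) (auto simp: T_def)
      qed
      then have "ereal (real (card U) * t - real (card T) * t) \<le> KL k q (spike U t)"
        using KL_ge_uncovered_mass[OF q True, of "spike U t"] by (simp add: T_def)
      also have "\<dots> \<le> ereal \<epsilon>"
        using qE by (simp add: E_def)
      finally have "(real (card U) - real (card T)) * t \<le> real (k - 1) / 4 * t"
        using t by (simp add: left_diff_distrib)
      then have "real (card U) - real (card T) \<le> real (k - 1) / 4"
        using t(1) by (rule mult_right_le_imp_le)
      then show False
        using U few by (auto simp: T_def)
    qed
    then have "sum ?l ?H = 0"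
      by (intro sum.neutral) auto
    also have "\<dots> \<le> sum ?r ?P"
      by (intro sum_nonneg r_nn)
    finally show ?thesis .
  next
    case False
    then obtain i where i: "i \<in> set_pmf q" "i \<noteq> 1" "i \<notin> set xs"
      by (auto simp: T_def)
    let ?Q = "{S \<in> Pow {2..k}. i \<in> S}"
    \<comment> \<open>Since \<open>q\<close> charges \<open>i\<close>, it can succeed only for sets
      containing \<open>i\<close>.\<close>
    have "sum ?l ?H = sum ?l {S \<in> ?H. i \<in> S}"
      using in_E i by (intro sum.mono_neutral_right) (auto simp: indicator_def)
    also have "\<dots> \<le> sum ?l ?Q"
      by (intro sum_mono2) auto
    also have "\<dots> \<le> (\<Sum>S\<in>?Q. ?r (S - {i}))"
    proof (intro sum_mono)
      fix U assume U: "U \<in> ?Q"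
      have "q \<notin> E (U - {i})"
        using in_E[of "U - {i}"] i U by auto
      then have "?r (U - {i}) = pmf (replicate_pmf n (spike (U - {i}) t)) xs"
        using q by simp
      moreover have "?l U \<le> pmf (replicate_pmf n (spike U t)) xs"
        by (simp add: indicator_def)
      moreover have "\<dots> \<le> pmf (replicate_pmf n (spike (U - {i}) t)) xs"
        using U S[of U] t i xs by (intro pmf_replicate_spike_le_Diff) auto
      ultimately show "?l U \<le> ?r (U - {i})" by linarith
    qed
    \<comment> \<open>Removal of \<open>i\<close> is injective on the sets containing
      \<open>i\<close>, so no failure term is used twice.\<close>
    also have "\<dots> = sum ?r ((\<lambda>S. S - {i}) ` ?Q)"
      by (subst sum.reindex) (auto simp: inj_on_def)
    also have "\<dots> \<le> sum ?r ?P"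
      by (intro sum_mono2 r_nn) auto
    finally show ?thesis .
  qed
qed

text \<open>On words with few distinct letters, the total success over the large sets
  \<open>H\<close> is at most the total failure over all sets, hence at most
  \<open>2 ^ K * \<delta>\<close> after summation over words. The other words have probability at
  most \<open>\<tau>\<close>. As \<open>H\<close> contains at least half of all sets,
  \<open>\<tau>\<close> cannot be small.\<close>

lemma learnable_KL_ge_card:
  assumes L: "learnable (KL k) k \<epsilon> \<delta> n"
    and k: "2 \<le> k" and \<epsilon>: "0 < \<epsilon>" "\<epsilon> \<le> 1 / 4" and \<delta>: "\<delta> \<le> 1 / 8"
  shows "k / (64 * \<epsilon>) \<le> n"
proof -
  let ?W = "{xs. set xs \<subseteq> {1..k} \<and> length xs = n}"
  obtain A where A: "\<And>xs. prob_space (A xs)" "\<And>xs. sets (A xs) = sets (simplex_space k)"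
    and succ: "\<And>p. p \<in> prob_simplex k \<Longrightarrow> 1 - \<delta> \<le> (\<Sum>xs\<in>?W.
        pmf (replicate_pmf n p) xs * measure (A xs) {q \<in> prob_simplex k. KL k q p \<le> ereal \<epsilon>})"
    by (rule learnableE[OF L]) blast
  define K where "K = k - 1"
  \<comment> \<open>The full set \<open>{2..k}\<close> gets mass
    \<open>4 * \<epsilon> \<le> 1\<close>. A set in \<open>H\<close> then has mass at least
    \<open>2 * \<epsilon>\<close>, and in a word with \<open>few\<close> the points seen account for
    less than \<open>\<epsilon>\<close>.\<close>
  define t where "t = 4 * \<epsilon> / K"
  define E where "E S = {q \<in> prob_simplex k. KL k q (spike S t) \<le> ereal \<epsilon>}" for S
  define H where "H = {S. S \<subseteq> {2..k} \<and> K \<le> 2 * card S}"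
  define P where "P S xs = pmf (replicate_pmf n (spike S t)) xs" for S xs
  define few where "few xs \<longleftrightarrow> 4 * card (set xs - {1}) < K" for xs :: "nat list"
  have K: "0 < K" "real K * t = 4 * \<epsilon>"
    using k by (auto simp: K_def t_def)
  have t: "0 < t"
    using K \<epsilon> by (simp add: t_def)
  have fin: "finite ?W" "finite H"
    by (auto simp: H_def intro: finite_lists_over)
  have card_S: "real (card S) * t \<le> 4 * \<epsilon>" if "S \<subseteq> {2..k}" for S
  proof -
    have "card S \<le> K"
      using card_mono[OF _ that] by (simp add: K_def)
    then have "real (card S) * t \<le> real K * t"
      using t by (intro mult_right_mono) auto
    then show ?thesis using K by simp
  qed
  have spike: "spike S t \<in> prob_simplex k" if "S \<subseteq> {2..k}" for S
    using card_S[OF that] that t \<epsilon> k by (intro spike_in_prob_simplex) auto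
  have P_nn: "0 \<le> P S xs" for S xs
    by (simp add: P_def)
  have sum_P: "(\<Sum>xs\<in>?W. P S xs) = 1" if "S \<subseteq> {2..k}" for S
    using spike[OF that] unfolding P_def
    by (intro sum_pmf_eq_1 fin) (auto simp: set_replicate_pmf prob_simplex_def)
  have E_sets: "E S \<in> sets (A xs)" for S xs
    using A KL_ball_in_sets by (simp add: E_def)
  have space_A: "space (A xs) = prob_simplex k" for xs
    using sets_eq_imp_space_eq[OF A(2)] by simp
  have swap: "(\<Sum>S\<in>H. P S xs * measure (A xs) (E S))
      \<le> (\<Sum>S\<in>Pow {2..k}. P S xs * (1 - measure (A xs) (E S)))" if "xs \<in> ?W" "few xs" for xs
  proof -
    have "(\<Sum>S\<in>H. P S xs * measure (A xs) (E S))
        \<le> (\<Sum>S\<in>Pow {2..k}. P S xs * measure (A xs) (prob_simplex k - E S))"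
    proof (rule prob_space.sum_prob_le_of_indicator_le[OF A(1)])
      fix q assume "q \<in> space (A xs)"
      then show "(\<Sum>S\<in>H. P S xs * indicator (E S) q)
          \<le> (\<Sum>S\<in>Pow {2..k}. P S xs * indicator (prob_simplex k - E S) q)"
        using k \<epsilon> t K that unfolding H_def P_def E_def K_def few_def
        by (intro sum_success_le_sum_failure) (auto simp: space_A)
    next
      show "prob_simplex k - E S \<in> sets (A xs)" for S
        using E_sets sets.compl_sets[of "E S" "A xs"] by (simp add: space_A)
    qed (use fin E_sets in auto)
    also have "\<dots> = (\<Sum>S\<in>Pow {2..k}. P S xs * (1 - measure (A xs) (E S)))"
      using prob_space.prob_compl[OF A(1) E_sets] by (simp add: space_A)
    finally show ?thesis .
  qed
  \<comment> \<open>Markov's inequality for the number of letters other than 1: its mean is at most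
    \<open>4 * n * \<epsilon>\<close>, and it is at least \<open>K / 4\<close> when
    \<open>few\<close> fails.\<close>
  have few_sum: "(\<Sum>xs\<in>?W. if few xs then 0 else P S xs) \<le> 16 * n * \<epsilon> / K" if S: "S \<subseteq> {2..k}" for S
  proof -
    have fS: "finite S" "1 \<notin> S"
      using S finite_subset by auto
    let ?p = "spike S t"
    have "(\<Sum>xs\<in>?W. if few xs then 0 else P S xs)
        \<le> (\<Sum>xs\<in>?W. 4 / K * (prod_list (map (pmf ?p) xs) * length (filter (\<lambda>x. x \<noteq> 1) xs)))"
    proof (intro sum_mono)
      fix xs assume xs: "xs \<in> ?W"
      have "set xs - {1} = set (filter (\<lambda>x. x \<noteq> 1) xs)"
        by auto
      then have "card (set xs - {1}) \<le> length (filter (\<lambda>x. x \<noteq> 1) xs)"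
        by (simp only: card_length)
      then have "1 \<le> 4 / K * length (filter (\<lambda>x. x \<noteq> 1) xs)" if "\<not> few xs"
        using that K(1) by (simp add: few_def pos_le_divide_eq)
      then have "P S xs * 1 \<le> P S xs * (4 / K * length (filter (\<lambda>x. x \<noteq> 1) xs))" if "\<not> few xs"
        using that P_nn by (intro mult_left_mono) auto
      moreover have "0 \<le> 4 / K * (P S xs * length (filter (\<lambda>x. x \<noteq> 1) xs))"
        using P_nn by (intro mult_nonneg_nonneg) auto
      moreover have "P S xs = prod_list (map (pmf ?p) xs)"
        using xs by (simp add: P_def pmf_replicate_pmf)
      ultimately show "(if few xs then 0 else P S xs)
          \<le> 4 / K * (prod_list (map (pmf ?p) xs) * length (filter (\<lambda>x. x \<noteq> 1) xs))"
        by (auto simp: mult_ac)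
    qed
    also have "\<dots> = 4 / K * (n * (\<Sum>x | x \<in> {1..k} \<and> x \<noteq> 1. pmf ?p x))"
      using sum_pmf_prob_simplex[OF spike[OF S]]
      by (simp only: sum_prod_list_length_filter finite_atLeastAtMost flip: sum_distrib_left)
    also have "(\<Sum>x | x \<in> {1..k} \<and> x \<noteq> 1. pmf ?p x) = (\<Sum>x\<in>S. t)"
      using S fS t card_S[OF S] \<epsilon> by (intro sum.mono_neutral_cong_right) (auto simp: pmf_spike)
    also have "4 / K * (n * (\<Sum>x\<in>S. t)) \<le> 4 / K * (n * (4 * \<epsilon>))"
      using card_S[OF S] by (intro mult_left_mono) auto
    finally show ?thesis by simp
  qed
  define \<tau> where "\<tau> = 16 * n * \<epsilon> / K"
  have succ': "1 - \<delta> \<le> (\<Sum>xs\<in>?W. P S xs * measure (A xs) (E S))" if "S \<subseteq> {2..k}" for S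
    using succ[OF spike[OF that]] by (simp add: P_def E_def)
  have "card H * (1 - \<delta>) \<le> (\<Sum>S\<in>H. \<Sum>xs\<in>?W. P S xs * measure (A xs) (E S))"
    using succ' by (intro sum_bounded_below) (auto simp: H_def)
  also have "\<dots> \<le> (\<Sum>S\<in>H. (\<Sum>xs\<in>?W. if few xs then 0 else P S xs)
      + (\<Sum>xs\<in>?W. if few xs then P S xs * measure (A xs) (E S) else 0))"
    unfolding sum.distrib[symmetric] using P_nn prob_space.prob_le_1[OF A(1)]
    by (intro sum_mono) (auto intro: mult_left_le)
  also have "\<dots> = (\<Sum>S\<in>H. \<Sum>xs\<in>?W. if few xs then 0 else P S xs)
      + (\<Sum>xs\<in>?W. \<Sum>S\<in>H. if few xs then P S xs * measure (A xs) (E S) else 0)"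
    by (simp only: sum.distrib) (subst (2) sum.swap, rule refl)
  also have "\<dots> \<le> card H * \<tau> + (\<Sum>xs\<in>?W. \<Sum>S\<in>Pow {2..k}. P S xs * (1 - measure (A xs) (E S)))"
  proof (rule add_mono)
    show "(\<Sum>S\<in>H. \<Sum>xs\<in>?W. if few xs then 0 else P S xs) \<le> card H * \<tau>"
      using few_sum by (intro sum_bounded_above) (auto simp: H_def \<tau>_def)
    show "(\<Sum>xs\<in>?W. \<Sum>S\<in>H. if few xs then P S xs * measure (A xs) (E S) else 0)
        \<le> (\<Sum>xs\<in>?W. \<Sum>S\<in>Pow {2..k}. P S xs * (1 - measure (A xs) (E S)))"
    proof (intro sum_mono)
      fix xs assume xs: "xs \<in> ?W"
      have "0 \<le> (\<Sum>S\<in>Pow {2..k}. P S xs * (1 - measure (A xs) (E S)))"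
        using P_nn prob_space.prob_le_1[OF A(1)] by (intro sum_nonneg mult_nonneg_nonneg) auto
      then show "(\<Sum>S\<in>H. if few xs then P S xs * measure (A xs) (E S) else 0)
          \<le> (\<Sum>S\<in>Pow {2..k}. P S xs * (1 - measure (A xs) (E S)))"
        using swap[OF xs] by (cases "few xs") auto
    qed
  qed
  also have "(\<Sum>xs\<in>?W. \<Sum>S\<in>Pow {2..k}. P S xs * (1 - measure (A xs) (E S)))
      = (\<Sum>S\<in>Pow {2..k}. (\<Sum>xs\<in>?W. P S xs) - (\<Sum>xs\<in>?W. P S xs * measure (A xs) (E S)))"
    by (subst sum.swap) (simp only: right_diff_distrib mult_1_right sum_subtractf)
  also have "\<dots> \<le> card (Pow {2..k}) * \<delta>"
  proof (rule sum_bounded_above)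
    fix S assume "S \<in> Pow {2..k}"
    then show "(\<Sum>xs\<in>?W. P S xs) - (\<Sum>xs\<in>?W. P S xs * measure (A xs) (E S)) \<le> \<delta>"
      using succ'[of S] sum_P[of S] by simp
  qed
  also have "\<dots> = 2 ^ K * \<delta>"
    by (simp add: card_Pow K_def)
  finally have main: "card H * (1 - \<delta>) \<le> card H * \<tau> + 2 ^ K * \<delta>"
    by simp
  have "2 ^ K \<le> 2 * card H"
    using card_large_subsets[of "{2..k}"] by (simp add: H_def K_def)
  then have H: "2 ^ K \<le> 2 * real (card H)"
    by (metis of_nat_le_iff of_nat_mult of_nat_numeral of_nat_power)
  then have "0 < real (card H)"
    by (smt (verit) zero_less_power)
  moreover have "2 ^ K * \<delta> \<le> 2 ^ K * (1 / 8)"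
    using \<delta> by (intro mult_left_mono) auto
  moreover have "card H * (7 / 8) \<le> card H * (1 - \<delta>)"
    using \<delta> by (intro mult_left_mono) auto
  \<comment> \<open>Here \<open>2 ^ K * \<delta> \<le> 2 ^ K / 8 \<le> card H / 4\<close>.\<close>
  ultimately have "card H * (7 / 8) \<le> card H * (\<tau> + 1 / 4)"
    using main H unfolding distrib_left by linarith
  then have "5 / 8 \<le> \<tau>"
    using \<open>0 < real (card H)\<close> by (simp add: mult_le_cancel_left_pos)
  then have "5 * K \<le> 128 * (\<epsilon> * n)"
    using K by (simp add: \<tau>_def field_simps)
  moreover have "real k \<le> 2 * K"
    using k by (simp add: K_def)
  \<comment> \<open>The computation gives the factor \<open>256 / 5\<close>, which is rounded up to
    64.\<close>
  ultimately have "k \<le> 64 * (\<epsilon> * n)"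
    by linarith
  then show ?thesis
    using \<epsilon> by (simp add: field_simps)
qed

section \<open>Sample complexity\<close>

lemma sample_complexity_KL_le:
  assumes k: "1 \<le> k" and \<epsilon>: "0 < \<epsilon>" "\<epsilon> \<le> 1" and \<delta>: "0 < \<delta>" "\<delta> \<le> 1"
  shows "ereal_of_enat (sample_complexity (KL k) k \<epsilon> \<delta>) \<le> ereal (17 * ((k + ln (1 / \<delta>)) / \<epsilon>))"
proof -
  \<comment> \<open>The smallest value making the exponent \<open>8 * k - x * \<epsilon> / 2\<close>
    equal to \<open>ln \<delta>\<close>; the 8 comes from \<open>9 \<le> exp 8\<close>.\<close>
  define x where "x = 2 * (8 * k + ln (1 / \<delta>)) / \<epsilon>"
  define n where "n = nat \<lceil>x\<rceil>"
  have ln_nn: "0 \<le> ln (1 / \<delta>)"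
    using \<delta> by (simp add: ln_div)
  then have "0 < x"
    using k \<epsilon> by (simp add: x_def)
  then have n: "0 < n" "x \<le> n" "n \<le> x + 1"
    unfolding n_def by linarith+
  have "(9::real) \<le> exp 8"
    using exp_ge_add_one_self[of 8] by simp
  then have "(9::real) ^ k \<le> exp 8 ^ k"
    by (intro power_mono) auto
  then have "9 ^ k * exp (- (real n * \<epsilon> / 2)) \<le> exp (8 * k) * exp (- (real n * \<epsilon> / 2))"
    by (simp add: mult_ac flip: exp_of_nat_mult)
  also have "\<dots> = exp (8 * k - real n * \<epsilon> / 2)"
    by (simp flip: exp_add)
  also have "\<dots> \<le> exp (- ln (1 / \<delta>))"
    using n(2) \<epsilon> by (simp add: x_def field_simps)
  also have "\<dots> = \<delta>"
    using \<delta> by (simp add: ln_div)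
  finally have "learnable (KL k) k \<epsilon> \<delta> n"
    using k n by (intro learnable_KL)
  then have "sample_complexity (KL k) k \<epsilon> \<delta> \<le> enat n"
    unfolding sample_complexity_def by (intro Inf_lower) auto
  then have "ereal_of_enat (sample_complexity (KL k) k \<epsilon> \<delta>) \<le> ereal n"
    by (metis ereal_of_enat_le_iff ereal_of_enat_simps(1))
  \<comment> \<open>The value \<open>x\<close> contributes 16, and rounding up contributes at most
    1, which the quotient dominates because \<open>k \<ge> 1\<close> and
    \<open>\<epsilon> \<le> 1\<close>.\<close>
  also have "real n \<le> 17 * ((k + ln (1 / \<delta>)) / \<epsilon>)"
  proof -
    have "1 \<le> (k + ln (1 / \<delta>)) / \<epsilon>"
      using k \<epsilon> ln_nn by (simp add: pos_le_divide_eq)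
    moreover have "x \<le> 16 * ((k + ln (1 / \<delta>)) / \<epsilon>)"
      using \<epsilon> ln_nn by (simp add: x_def field_simps)
    ultimately show ?thesis
      using n(3) by linarith
  qed
  finally show ?thesis by simp
qed

text \<open>The sample size is at least the mean of the two lower bounds
  \<open>k / (64 * \<epsilon>)\<close> and \<open>ln (1 / \<delta>) / (8 * \<epsilon>)\<close>,
  whence the constant \<open>1 / 128\<close>.\<close>

lemma sample_complexity_KL_ge:
  assumes k: "2 \<le> k" and \<epsilon>: "0 < \<epsilon>" "\<epsilon> \<le> 1 / 4" and \<delta>: "0 < \<delta>" "\<delta> \<le> 1 / 8"
  shows "ereal (1 / 128 * ((k + ln (1 / \<delta>)) / \<epsilon>)) \<le> ereal_of_enat (sample_complexity (KL k) k \<epsilon> \<delta>)"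
proof -
  let ?X = "{enat n | n. learnable (KL k) k \<epsilon> \<delta> n}"
  have ge: "1 / 128 * ((k + ln (1 / \<delta>)) / \<epsilon>) \<le> n" if "learnable (KL k) k \<epsilon> \<delta> n" for n
  proof -
    have "0 \<le> ln (1 / \<delta>) / \<epsilon>"
      using \<epsilon> \<delta> by (intro divide_nonneg_pos ln_ge_zero) auto
    then have "1 / 128 * ((k + ln (1 / \<delta>)) / \<epsilon>) \<le> (k / (64 * \<epsilon>) + ln (1 / \<delta>) / (8 * \<epsilon>)) / 2"
      using \<epsilon> by (simp add: add_divide_distrib)
    also have "\<dots> \<le> n"
      using learnable_KL_ge_card[OF that k \<epsilon> \<delta>(2)] learnable_KL_ge_ln[OF that k \<epsilon> \<delta>] by simp
    finally show ?thesis .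
  qed
  show ?thesis
  proof (cases "?X = {}")
    case True
    then show ?thesis
      by (simp add: sample_complexity_def Inf_enat_def)
  next
    case False
    \<comment> \<open>A nonempty set of extended naturals attains its infimum, so the bound for a
      single learnable \<open>n\<close> applies to it.\<close>
    then have "Inf ?X \<in> ?X"
      unfolding Inf_enat_def by (simp only: if_False) (meson LeastI ex_in_conv)
    then obtain n where "Inf ?X = enat n" "learnable (KL k) k \<epsilon> \<delta> n"
      by blast
    with ge show ?thesis
      by (simp add: sample_complexity_def)
  qed
qed

text \<open>The thresholds 2, \<open>1 / 4\<close> and \<open>1 / 8\<close> are those of the lower
  bound and lie within the range of the upper bound.\<close>

theorem theorem8:
  "\<exists>(c::real) (C::real) (k0::nat) (\<epsilon>0::real) (\<delta>0::real).
     0 < c \<and> c \<le> C \<and> 0 < \<epsilon>0 \<and> 0 < \<delta>0 \<and>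
     (\<forall>(k::nat) (\<epsilon>::real) (\<delta>::real).
        k0 \<le> k \<and> 0 < \<epsilon> \<and> \<epsilon> \<le> \<epsilon>0 \<and> 0 < \<delta> \<and> \<delta> \<le> \<delta>0 \<longrightarrow>
          ereal (c * ((real k + ln (1 / \<delta>)) / \<epsilon>))
            \<le> ereal_of_enat (sample_complexity (KL k) k \<epsilon> \<delta>) \<and>
          ereal_of_enat (sample_complexity (KL k) k \<epsilon> \<delta>)
            \<le> ereal (C * ((real k + ln (1 / \<delta>)) / \<epsilon>)))"
  by (rule exI[of _ "1 / 128"], rule exI[of _ 17], rule exI[of _ 2], rule exI[of _ "1 / 4"],
      rule exI[of _ "1 / 8"])
    (intro conjI allI impI sample_complexity_KL_ge sample_complexity_KL_le, auto)

end
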